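(* Let $G(V,E)$ be a graph with $n=|V|$. Suppose $A\subseteq V$ with $|A|\le k$ and $G[V\setminus A]$ is a clique. Then (a) $box(G)\le k$, and (b) an optimal box representation of $G$ (one of dimension $box(G)$) can be found in time $n^2\,2^{O(k^2\log k)}$.
   Context: A graph is an interval graph if one can assign to each vertex a closed interval of $\mathbb{R}$ such that two distinct vertices are adjacent iff their intervals intersect. For a graph $G(V,E)$, a box representation of dimension $k$ is a collection $\{I_1,\dots,I_k\}$ of interval graphs on vertex set $V$ with $E(G)=\bigcap_i E(I_i)$. The boxicity $box(G)$ of an incomplete graph is the minimum dimension of a box representation, and $0$ for a complete graph. $G[S]$ denotes the induced subgraph on $S$. *)

theory Defs
  imports Complex_Main
begin

text \<open>A finite simple graph is a vertex set together with a set of two-element sets of vertices.\<close>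

definition all_edges :: "'a set \<Rightarrow> 'a set set" where
  "all_edges V = {{u, v} | u v. u \<in> V \<and> v \<in> V \<and> u \<noteq> v}"

definition simple_graph :: "'a set \<Rightarrow> 'a set set \<Rightarrow> bool" where
  "simple_graph V E \<longleftrightarrow> finite V \<and> E \<subseteq> all_edges V"

definition complete_graph :: "'a set \<Rightarrow> 'a set set \<Rightarrow> bool" where
  "complete_graph V E \<longleftrightarrow> E = all_edges V"

definition induced_edges :: "'a set set \<Rightarrow> 'a set \<Rightarrow> 'a set set" where
  "induced_edges E S = {e \<in> E. e \<subseteq> S}"

definition interval_graph :: "'a set \<Rightarrow> 'a set set \<Rightarrow> bool" where
  "interval_graph V E \<longleftrightarrow> simple_graph V E \<and>
     (\<exists>l r :: 'a \<Rightarrow> real. (\<forall>v\<in>V. l v \<le> r v) \<and>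
        (\<forall>u\<in>V. \<forall>v\<in>V. u \<noteq> v \<longrightarrow>
           ({u, v} \<in> E \<longleftrightarrow> {l u..r u} \<inter> {l v..r v} \<noteq> {})))"

text \<open>
  The list contains the edge sets of the interval graphs, and its length is the dimension.
  Intersecting with \<^term>\<open>all_edges V\<close> only matters for the empty list: there
  \<^term>\<open>\<Inter> (set Is)\<close> is the universe, so that the empty collection represents exactly
  the complete graphs.
\<close>

definition box_representation :: "'a set \<Rightarrow> 'a set set \<Rightarrow> 'a set set list \<Rightarrow> bool" where
  "box_representation V E Is \<longleftrightarrow>
     (\<forall>I\<in>set Is. interval_graph V I) \<and> E = all_edges V \<inter> \<Inter> (set Is)"

definition boxicity :: "'a set \<Rightarrow> 'a set set \<Rightarrow> nat" where
  "boxicity V E =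
     (if complete_graph V E then 0
      else (LEAST k. \<exists>Is. length Is = k \<and> box_representation V E Is))"

text \<open>
  The machine model is the random access machine under the uniform cost criterion, with addition
  and truncated subtraction as its only arithmetic (there is no unit-cost multiplication),
  in the form of structured programs. A state consists of registers, which are
  named by the constants occurring in a program, and of an indirectly addressed memory.
  Every operator, constant, register access, memory access, assignment and test costs one step.
\<close>

type_synonym state = "(nat \<Rightarrow> nat) \<times> (nat \<Rightarrow> nat)"

datatype expr =
    Const nat
  | Reg nat
  | Mem expr
  | Add expr expr
  | Sub expr expr

fun eval :: "expr \<Rightarrow> state \<Rightarrow> nat" where
  "eval (Const c) s = c"
| "eval (Reg x) s = fst s x"
| "eval (Mem e) s = snd s (eval e s)"
| "eval (Add e f) s = eval e s + eval f s"
| "eval (Sub e f) s = eval e s - eval f s"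

fun cost :: "expr \<Rightarrow> nat" where
  "cost (Const c) = 1"
| "cost (Reg x) = 1"
| "cost (Mem e) = cost e + 1"
| "cost (Add e f) = cost e + cost f + 1"
| "cost (Sub e f) = cost e + cost f + 1"

datatype prog =
    Skip
  | SetReg nat expr
  | SetMem expr expr
  | Seq prog prog
  | If expr prog prog
  | While expr prog

text \<open>
  \<open>run P s t s'\<close> means that \<open>P\<close>, started in \<open>s\<close>, halts in \<open>s'\<close> after \<open>t\<close> steps.
  A test succeeds if its value is nonzero.
\<close>

inductive run :: "prog \<Rightarrow> state \<Rightarrow> nat \<Rightarrow> state \<Rightarrow> bool" where
  run_Skip: "run Skip s 1 s"
| run_SetReg: "run (SetReg x e) s (cost e + 1) ((fst s)(x := eval e s), snd s)"
| run_SetMem: "run (SetMem e f) s (cost e + cost f + 1) (fst s, (snd s)(eval e s := eval f s))"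
| run_Seq: "run P s t s' \<Longrightarrow> run Q s' t' s'' \<Longrightarrow> run (Seq P Q) s (t + t') s''"
| run_If_True: "eval e s \<noteq> 0 \<Longrightarrow> run P s t s' \<Longrightarrow> run (If e P Q) s (cost e + 1 + t) s'"
| run_If_False: "eval e s = 0 \<Longrightarrow> run Q s t s' \<Longrightarrow> run (If e P Q) s (cost e + 1 + t) s'"
| run_While_True: "eval e s \<noteq> 0 \<Longrightarrow> run P s t s' \<Longrightarrow> run (While e P) s' t' s'' \<Longrightarrow>
    run (While e P) s (cost e + 1 + t + t') s''"
| run_While_False: "eval e s = 0 \<Longrightarrow> run (While e P) s (cost e + 1) s"

text \<open>
  Graphs are stored as adjacency matrices, row by row, with respect to an enumeration \<open>vs\<close>
  of the vertices. Initially register 0 holds the number of vertices and the memory holds the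
  matrix from address 0 on; everything else is 0. In the end register 0 holds the number of
  graphs and register 1 the address at which their matrices are stored consecutively.
\<close>

definition input_state :: "'a list \<Rightarrow> 'a set set \<Rightarrow> state" where
  "input_state vs E =
     (let n = length vs in
       (\<lambda>x. if x = 0 then n else 0,
        \<lambda>a. if a < n * n \<and> {vs ! (a div n), vs ! (a mod n)} \<in> E then 1 else 0))"

definition output_graphs :: "'a list \<Rightarrow> state \<Rightarrow> 'a set set list \<Rightarrow> bool" where
  "output_graphs vs s Is \<longleftrightarrow>
     (let n = length vs in
       fst s 0 = length Is \<and>
       (\<forall>d < length Is. \<forall>i < n. \<forall>j < n.
          snd s (fst s 1 + d * (n * n) + i * n + j) =
            (if {vs ! i, vs ! j} \<in> Is ! d then 1 else 0)))"

end

theory Submission imports Defs begin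

text \<open>
  Let \<open>A\<close> be a set of vertices whose complement \<open>B\<close> is a clique. For every \<open>a\<close> in \<open>A\<close>, the graph
  all of whose non-edges are the pairs \<open>{a, v}\<close> missing in \<open>E\<close> is an interval graph, and these
  graphs intersect in \<open>E\<close>; this gives \<open>box(G) \<le> |A|\<close>.

  For the algorithm, a greedy maximal matching of the complement graph yields, in quadratic time,
  a set \<open>S\<close> with at most \<open>2 |A|\<close> vertices that also has a clique as complement. In an interval
  supergraph of \<open>G\<close> the vertices outside \<open>S\<close> form a clique, hence by Helly's theorem their
  intervals share a point \<open>p\<close>. Keep the intervals of \<open>S\<close>, and shrink that of every other vertex to
  the smallest interval that contains \<open>p\<close> and meets the intervals of its neighbours in \<open>S\<close>: the
  result still contains \<open>G\<close> and has no new edge. So an interval graph is determined by \<open>p\<close> and the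
  endpoints of \<open>S\<close>, of which only the relative order matters. After replacing them by ranks,
  shifted such that \<open>p\<close> becomes \<open>P = 2 |S| + 1\<close>, a left endpoint and a length are numbers below
  \<open>2 P\<close>, and a \<open>d\<close>-tuple of interval graphs is a number with \<open>2 |S| d\<close> digits in base \<open>2 P\<close>.
  Trying all these numbers for \<open>d = 0, 1, 2, \<dots>\<close> finds an optimal representation after
  \<open>2\<^bsup>O(k\<^sup>2 log k)\<^esup>\<close> attempts, each of which may even take time linear in the number tried, so
  that digits can be extracted by repeated subtraction.
\<close>

section \<open>Weakest preconditions with running time\<close>

text \<open>Asserts that a halting run exists and lets the postcondition speak about its number of
  steps, so that termination, correctness and running time are proved in one pass.\<close>

definition wp :: "prog \<Rightarrow> state \<Rightarrow> (nat \<Rightarrow> state \<Rightarrow> bool) \<Rightarrow> bool" where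
  "wp P s Q \<longleftrightarrow> (\<exists>t s'. run P s t s' \<and> Q t s')"

inductive_cases run_SkipE: "run Skip s t s'"
inductive_cases run_SetRegE: "run (SetReg x e) s t s'"
inductive_cases run_SetMemE: "run (SetMem e f) s t s'"
inductive_cases run_SeqE: "run (Seq P Q) s t s'"
inductive_cases run_IfE: "run (If e P Q) s t s'"

lemma wp_Skip: "wp Skip s Q \<longleftrightarrow> Q 1 s"
  unfolding wp_def by (metis run_Skip run_SkipE)

lemma wp_SetReg:
  "wp (SetReg x e) s Q \<longleftrightarrow> Q (cost e + 1) ((fst s)(x := eval e s), snd s)"
  unfolding wp_def by (metis run_SetReg run_SetRegE)

lemma wp_SetMem:
  "wp (SetMem e f) s Q \<longleftrightarrow> Q (cost e + cost f + 1) (fst s, (snd s)(eval e s := eval f s))"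
  unfolding wp_def by (metis run_SetMem run_SetMemE)

lemma wp_Seq:
  "wp (Seq P P') s Q \<longleftrightarrow> wp P s (\<lambda>t s'. wp P' s' (\<lambda>t'. Q (t + t')))"
  unfolding wp_def by (blast elim: run_SeqE intro: run.intros)

lemma wp_If:
  "wp (If e P P') s Q \<longleftrightarrow>
     (if eval e s \<noteq> 0 then wp P s (\<lambda>t. Q (cost e + 1 + t)) else wp P' s (\<lambda>t. Q (cost e + 1 + t)))"
proof -
  have "run (If e P P') s t s' \<longleftrightarrow>
    (\<exists>u. t = cost e + 1 + u \<and> run (if eval e s \<noteq> 0 then P else P') s u s')" for t s'
    by (cases "eval e s = 0")
      (fastforce elim!: run_IfE intro: run_If_False run_If_True)+
  then show ?thesis unfolding wp_def by auto
qed

lemmas wp_simps = wp_Skip wp_SetReg wp_SetMem wp_Seq wp_If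

lemma wp_mono:
  assumes "wp P s Q" and "\<And>t s'. Q t s' \<Longrightarrow> R t s'"
  shows "wp P s R"
  using assms unfolding wp_def by blast

text \<open>The measure \<open>f\<close> drops in every round, so there are at most
  \<open>f s\<close> rounds, each paying for the body and one test; the last summand is the final,
  failing test.\<close>

lemma wp_While:
  assumes "I s"
    and body: "\<And>s. I s \<Longrightarrow> eval e s \<noteq> 0 \<Longrightarrow> wp P s (\<lambda>t s'. t \<le> W \<and> I s' \<and> f s' < f s)"
  shows "wp (While e P) s
    (\<lambda>t s'. I s' \<and> eval e s' = 0 \<and> t \<le> f s * (W + cost e + 1) + cost e + 1)"
  using assms(1)
proof (induction "f s" arbitrary: s rule: less_induct)
  case less
  show ?case
  proof (cases "eval e s = 0")
    case True
    then have "run (While e P) s (cost e + 1) s" by (rule run_While_False)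
    then show ?thesis using less.prems True unfolding wp_def by fastforce
  next
    case False
    from body[OF less.prems False] obtain t s1
      where 1: "run P s t s1" "t \<le> W" "I s1" "f s1 < f s" unfolding wp_def by blast
    from less.hyps[OF 1(4,3)] obtain t' s2
      where 2: "run (While e P) s1 t' s2" "I s2" "eval e s2 = 0"
        "t' \<le> f s1 * (W + cost e + 1) + cost e + 1" unfolding wp_def by blast
    have "run (While e P) s (cost e + 1 + t + t') s2"
      using run_While_True[OF False 1(1) 2(1)] .
    moreover have "Suc (f s1) * (W + cost e + 1) \<le> f s * (W + cost e + 1)"
      using 1(4) by (intro mult_le_mono1) simp
    then have "cost e + 1 + t + t' \<le> f s * (W + cost e + 1) + cost e + 1"
      using 1(2) 2(4) by simp
    ultimately show ?thesis using 2 unfolding wp_def by blast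
  qed
qed

section \<open>The program\<close>

text \<open>
  Register 0 holds \<open>n\<close>, 1 the address of the output, 2 \<open>n\<^sup>2\<close>, 3 the common point \<open>P\<close>, 4 the
  current candidate, 5 the current dimension, 6 whether the candidate has passed the check,
  7 the digits of the candidate that have not yet been read, 8 the address of the matrix being
  written, 9 the index of the current interval graph; the others are scratch, where 10, 12 and 11
  are the row, the column and the position in the matrix. From address \<open>n\<^sup>2\<close> on, the memory holds
  the characteristic function of \<open>S\<close>, the left endpoints, the right endpoints (\<open>n\<close> cells each),
  and the output.
\<close>

definition grid :: "prog \<Rightarrow> prog" where
  "grid B =
    Seq (SetReg 10 (Const 0)) (Seq (SetReg 11 (Const 0))
      (While (Sub (Reg 0) (Reg 10))
        (Seq (SetReg 12 (Const 0))
        (Seq (While (Sub (Reg 0) (Reg 12))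
                (Seq B (Seq (SetReg 11 (Add (Reg 11) (Const 1)))
                            (SetReg 12 (Add (Reg 12) (Const 1))))))
          (SetReg 10 (Add (Reg 10) (Const 1)))))))"

text \<open>\<open>J p\<close> describes the state once the first \<open>p\<close> positions are
  done. By \<open>stable\<close> it is blind to the three loop registers, so advancing them cannot
  invalidate it; \<open>body\<close> must leave them and \<open>n\<close> alone.\<close>

lemma wp_grid:
  assumes n: "fst s 0 = n"
    and init: "J 0 s"
    and stable: "\<And>p s u v w. J p s \<Longrightarrow> J p ((fst s)(10 := u, 11 := v, 12 := w), snd s)"
    and body: "\<And>p s. p < n * n \<Longrightarrow> J p s \<Longrightarrow> fst s 0 = n \<Longrightarrow> fst s 10 = p div n \<Longrightarrow>
       fst s 11 = p \<Longrightarrow> fst s 12 = p mod n \<Longrightarrow>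
       wp B s (\<lambda>t s'. t \<le> W \<and> J (Suc p) s' \<and> (\<forall>x\<in>{0, 10, 11, 12}. fst s' x = fst s x))"
  shows "wp (grid B) s (\<lambda>t s'. J (n * n) s' \<and> t \<le> (W + 40) * (n * n + 1))"
proof -
  \<comment> \<open>\<open>I\<close> holds between rows, \<open>I'\<close> inside row
    \<open>i\<close>; both tie register 11 to the row and the column.\<close>
  define I where "I = (\<lambda>s. fst s 0 = n \<and> fst s 10 \<le> n \<and> fst s 11 = fst s 10 * n \<and> J (fst s 11) s)"
  define I' where "I' = (\<lambda>i s. fst s 0 = n \<and> fst s 10 = i \<and> i < n \<and> fst s 12 \<le> n \<and>
     fst s 11 = i * n + fst s 12 \<and> J (fst s 11) s)"
  have stable': "J p s \<Longrightarrow> fst s' = (fst s)(10 := u, 11 := v, 12 := w) \<Longrightarrow> snd s' = snd s \<Longrightarrow> J p s'" for p s s' u v w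
    using stable[of p s u v w] by (metis prod.collapse)
  have stable10: "J p s \<Longrightarrow> J p ((fst s)(10 := u), snd s)" for p s u
    by (rule stable'[of p s _ u "fst s 11" "fst s 12"]) (auto simp: fun_eq_iff)
  have stable12: "J p s \<Longrightarrow> J p ((fst s)(12 := u), snd s)" for p s u
    by (rule stable'[of p s _ "fst s 10" "fst s 11" u]) (auto simp: fun_eq_iff)
  have stable11: "J p s \<Longrightarrow> J p ((fst s)(11 := u, 12 := v), snd s)" for p s u v
    by (rule stable'[of p s _ "fst s 10" u v]) (auto simp: fun_eq_iff)
  have stable1: "J p s \<Longrightarrow> J p ((fst s)(10 := u, 11 := v), snd s)" for p s u v
    by (rule stable'[of p s _ u v "fst s 12"]) (auto simp: fun_eq_iff)
  have inner: "wp (While (Sub (Reg 0) (Reg 12))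
                (Seq B (Seq (SetReg 11 (Add (Reg 11) (Const 1)))
                            (SetReg 12 (Add (Reg 12) (Const 1)))))) s
     (\<lambda>t s'. I' i s' \<and> eval (Sub (Reg 0) (Reg 12)) s' = 0 \<and> t \<le> n * (W + 12) + 4)"
    if I': "I' i s" "fst s 12 = 0" for s i
  proof (rule wp_mono[OF wp_While[where I = "I' i" and W = "W + 8" and f = "\<lambda>s. n - fst s 12"]])
    show "I' i s" by fact
  next
    fix s assume s: "I' i s" "eval (Sub (Reg 0) (Reg 12)) s \<noteq> 0"
    define p where "p = i * n + fst s 12"
    have lt: "fst s 12 < n" using s by (simp add: I'_def)
    have *: "p < n * n" "p div n = i" "p mod n = fst s 12"
    proof -
      have "Suc i * n \<le> n * n" using s by (intro mult_le_mono1) (simp add: I'_def)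
      then show "p < n * n" using lt by (simp add: p_def)
    qed (use lt in \<open>simp_all add: p_def\<close>)
    have "wp B s (\<lambda>t s'. t \<le> W \<and> J (Suc p) s' \<and> (\<forall>x\<in>{0, 10, 11, 12}. fst s' x = fst s x))"
      using s * by (intro body) (auto simp: I'_def p_def)
    then show "wp (Seq B (Seq (SetReg 11 (Add (Reg 11) (Const 1)))
                            (SetReg 12 (Add (Reg 12) (Const 1))))) s
       (\<lambda>t s'. t \<le> W + 8 \<and> I' i s' \<and> n - fst s' 12 < n - fst s 12)"
      unfolding wp_Seq
      by (rule wp_mono) (use s lt in \<open>auto simp: wp_simps I'_def p_def intro!: stable11\<close>)
  qed (use that in \<open>auto simp: numeral_eq_Suc\<close>)
  have outer: "wp (While (Sub (Reg 0) (Reg 10))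
        (Seq (SetReg 12 (Const 0))
        (Seq (While (Sub (Reg 0) (Reg 12))
                (Seq B (Seq (SetReg 11 (Add (Reg 11) (Const 1)))
                            (SetReg 12 (Add (Reg 12) (Const 1))))))
          (SetReg 10 (Add (Reg 10) (Const 1)))))) s
     (\<lambda>t s'. I s' \<and> eval (Sub (Reg 0) (Reg 10)) s' = 0 \<and> t \<le> n * (14 + n * (W + 12)) + 4)"
    if I: "I s" "fst s 10 = 0" for s
  proof (rule wp_mono[OF wp_While[where I = I and W = "n * (W + 12) + 10" and f = "\<lambda>s. n - fst s 10"]])
    show "I s" by fact
  next
    fix s assume s: "I s" "eval (Sub (Reg 0) (Reg 10)) s \<noteq> 0"
    have "I' (fst s 10) ((fst s)(12 := 0), snd s)"
      using s stable12[of "fst s 11" s 0] by (auto simp: I_def I'_def)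
    note inner[OF this]
    then show "wp (Seq (SetReg 12 (Const 0))
        (Seq (While (Sub (Reg 0) (Reg 12))
                (Seq B (Seq (SetReg 11 (Add (Reg 11) (Const 1)))
                            (SetReg 12 (Add (Reg 12) (Const 1))))))
          (SetReg 10 (Add (Reg 10) (Const 1))))) s
       (\<lambda>t s'. t \<le> n * (W + 12) + 10 \<and> I s' \<and> n - fst s' 10 < n - fst s 10)"
      unfolding wp_Seq wp_SetReg
      by (simp, elim wp_mono) (use s in \<open>auto simp: wp_simps I_def I'_def intro!: stable10\<close>)
  qed (use that in auto)
  have "I ((fst s)(10 := 0, 11 := 0), snd s)"
    using n init stable1[of 0 s] by (simp add: I_def)
  note outer = outer[OF this]
  \<comment> \<open>The additional 4 steps are the two assignments that initialise the row and the
    position.\<close>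
  have bound: "J (n * n) s' \<and> t + 4 \<le> (W + 40) * (n * n + 1)"
    if "I s' \<and> fst s' 0 \<le> fst s' 10 \<and> t \<le> n * (14 + n * (W + 12)) + 4" for t s'
  proof -
    have "14 * n + 8 \<le> 28 * (n * n + 1)"
      by (cases n) auto
    moreover have "n * (14 + n * (W + 12)) + 4 + 4 = (W + 12) * (n * n) + (14 * n + 8)"
      by (simp add: algebra_simps)
    ultimately have "t + 4 \<le> (W + 40) * (n * n + 1)"
      using that by (simp add: algebra_simps)
    then show ?thesis using that by (auto simp: I_def)
  qed
  show ?thesis
    unfolding grid_def wp_Seq wp_SetReg
    using outer by simp (elim wp_mono, drule bound, simp)
qed

section \<open>Decoding a candidate number into intervals\<close>

definition divmod_prog :: prog where
  "divmod_prog =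
    Seq (SetReg 13 (Reg 7)) (Seq (SetReg 7 (Const 0))
      (While (Sub (Add (Reg 13) (Const 1)) (Add (Reg 3) (Reg 3)))
        (Seq (SetReg 13 (Sub (Reg 13) (Add (Reg 3) (Reg 3))))
             (SetReg 7 (Add (Reg 7) (Const 1))))))"

text \<open>Adding 1 before the truncated subtraction makes the loop test nonzero exactly when
  register 13 is at least the divisor. Every round lowers register 13, so the time is linear in the
  dividend.\<close>

lemma wp_divmod:
  assumes "fst s 3 > 0"
  shows "wp divmod_prog s (\<lambda>t s'. t \<le> 30 * (fst s 7 + 1) \<and>
    s' = ((fst s)(7 := fst s 7 div (2 * fst s 3), 13 := fst s 7 mod (2 * fst s 3)), snd s))"
proof -
  define P where "P = fst s 3"
  define X where "X = fst s 7"
  have P: "P > 0" using assms by (simp add: P_def)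
  define I where "I = (\<lambda>s'. \<exists>x y. s' = ((fst s)(7 := x, 13 := y), snd s) \<and> x * (2 * P) + y = X)"
  let ?e = "Sub (Add (Reg 13) (Const 1)) (Add (Reg 3) (Reg 3))"
  have "wp (While ?e
        (Seq (SetReg 13 (Sub (Reg 13) (Add (Reg 3) (Reg 3))))
             (SetReg 7 (Add (Reg 7) (Const 1))))) ((fst s)(13 := X, 7 := 0), snd s)
      (\<lambda>t s'. I s' \<and> eval ?e s' = 0 \<and> t \<le> X * (10 + cost ?e + 1) + cost ?e + 1)"
  proof (rule wp_mono[OF wp_While[where I = I and W = 10 and f = "\<lambda>s. fst s 13"]])
    show "I ((fst s)(13 := X, 7 := 0), snd s)"
      unfolding I_def by (rule exI[of _ 0], rule exI[of _ X]) auto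
    show "wp (Seq (SetReg 13 (Sub (Reg 13) (Add (Reg 3) (Reg 3))))
             (SetReg 7 (Add (Reg 7) (Const 1)))) s'
           (\<lambda>t s''. t \<le> 10 \<and> I s'' \<and> fst s'' 13 < fst s' 13)"
      if I: "I s'" and ne: "eval ?e s' \<noteq> 0" for s'
    proof -
      obtain x y where s': "s' = ((fst s)(7 := x, 13 := y), snd s)" and xy: "x * (2 * P) + y = X"
        using I by (auto simp: I_def)
      have "2 * P \<le> y" using ne by (simp add: s' P_def)
      then have "(x + 1) * (2 * P) + (y - 2 * P) = X" using xy by simp
      then have "I ((fst s)(7 := x + 1, 13 := y - 2 * P), snd s)"
        unfolding I_def by blast
      moreover have "(fst s)(7 := x + 1, 13 := y - 2 * P) =
          (fst s)(7 := x, 13 := y - (fst s 3 + fst s 3), 7 := Suc x)"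
        by (auto simp: P_def mult_2)
      ultimately show ?thesis
        using \<open>2 * P \<le> y\<close> P by (simp add: wp_simps s' P_def)
    qed
  qed auto
  then show ?thesis
    unfolding divmod_prog_def wp_Seq wp_SetReg
    apply (simp add: X_def[symmetric])
    apply (erule wp_mono)
  proof goal_cases
    case (1 t s')
    then obtain x y where s': "s' = ((fst s)(7 := x, 13 := y), snd s)" and xy: "x * (2 * P) + y = X"
      by (auto simp: I_def)
    have y: "y < 2 * P" using 1 by (auto simp: s' P_def)
    then have "X div (2 * P) = x" "X mod (2 * P) = y"
      using P by (auto simp: xy[symmetric])
    then show ?case using 1 by (auto simp: s' P_def)
  qed
qed

text \<open>The part of the state that stays fixed during the search. \<open>D\<close> encodes the
  graph as the set of the matrix positions \<open>i * n + j\<close> of its edges.\<close>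

definition env :: "nat \<Rightarrow> nat set \<Rightarrow> nat set \<Rightarrow> state \<Rightarrow> bool" where
  "env n D S s \<longleftrightarrow>
     fst s 0 = n \<and> fst s 1 = n * n + 3 * n \<and> fst s 2 = n * n \<and> fst s 3 = 2 * card S + 1 \<and>
     (\<forall>a < n * n. snd s a = of_bool (a \<in> D)) \<and> (\<forall>i < n. snd s (n * n + i) = of_bool (i \<in> S))"

lemma env_frame:
  assumes "env n D S s" "\<forall>x < 4. fst s' x = fst s x" "\<forall>a < n * n + n. snd s' a = snd s a"
  shows "env n D S s'"
  using assms by (simp add: env_def)

abbreviation L_addr :: "expr \<Rightarrow> expr" where
  "L_addr e \<equiv> Add (Reg 2) (Add (Reg 0) e)"

abbreviation R_addr :: "expr \<Rightarrow> expr" where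
  "R_addr e \<equiv> Add (Reg 2) (Add (Reg 0) (Add (Reg 0) e))"

text \<open>A vertex outside \<open>S\<close> starts with the degenerate interval at
  \<open>P\<close>, which \<open>extend_prog\<close> then enlarges.\<close>

definition decode_prog :: prog where
  "decode_prog =
    Seq (SetReg 10 (Const 0))
      (While (Sub (Reg 0) (Reg 10))
        (Seq (If (Mem (Add (Reg 2) (Reg 10)))
                (Seq divmod_prog (Seq (SetMem (L_addr (Reg 10)) (Reg 13))
                (Seq divmod_prog (SetMem (R_addr (Reg 10)) (Add (Mem (L_addr (Reg 10))) (Reg 13))))))
                (Seq (SetMem (L_addr (Reg 10)) (Reg 3)) (SetMem (R_addr (Reg 10)) (Reg 3))))
          (SetReg 10 (Add (Reg 10) (Const 1)))))"

definition base :: "nat set \<Rightarrow> nat" where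
  "base S = 2 * (2 * card S + 1)"

text \<open>The rank of \<open>i\<close> in \<open>S\<close>: the digits of a vertex of
  \<open>S\<close> are those at positions \<open>2 * cnt S i\<close> and
  \<open>2 * cnt S i + 1\<close>.\<close>

definition cnt :: "nat set \<Rightarrow> nat \<Rightarrow> nat" where
  "cnt S i = card (S \<inter> {..<i})"

lemma cnt_Suc: "cnt S (Suc i) = (if i \<in> S then Suc (cnt S i) else cnt S i)"
  by (simp add: cnt_def lessThan_Suc)

definition dec_left :: "nat set \<Rightarrow> nat \<Rightarrow> nat \<Rightarrow> nat" where
  "dec_left S X i = X div base S ^ (2 * cnt S i) mod base S"

text \<open>The second digit is a length, so that every number decodes to intervals that are not
  empty.\<close>

definition dec_right :: "nat set \<Rightarrow> nat \<Rightarrow> nat \<Rightarrow> nat" where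
  "dec_right S X i = dec_left S X i + X div base S ^ (2 * cnt S i + 1) mod base S"

text \<open>Each vertex of \<open>S\<close> consumes two digits of register 7, which therefore holds
  the quotient by \<open>base S ^ (2 * cnt S i)\<close> before vertex \<open>i\<close>; what remains
  in the end belongs to the next interval graphs.\<close>

lemma wp_decode:
  assumes env: "env n D S s" and S: "S \<subseteq> {..<n}"
  shows "wp decode_prog s (\<lambda>t s'. t \<le> n * (60 * fst s 7 + 200) + 10 \<and>
    (\<forall>x < 10. x \<noteq> 7 \<longrightarrow> fst s' x = fst s x) \<and> fst s' 7 = fst s 7 div base S ^ (2 * card S) \<and>
    (\<forall>a. a < n * n + n \<or> n * n + 3 * n \<le> a \<longrightarrow> snd s' a = snd s a) \<and>
    (\<forall>i < n. snd s' (n * n + (n + i)) = (if i \<in> S then dec_left S (fst s 7) i else 2 * card S + 1) \<and>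
       snd s' (n * n + (n + (n + i))) = (if i \<in> S then dec_right S (fst s 7) i else 2 * card S + 1)))"
proof -
  define X where "X = fst s 7"
  define I where "I = (\<lambda>s'. fst s' 10 \<le> n \<and>
    (\<forall>x < 10. x \<noteq> 7 \<longrightarrow> fst s' x = fst s x) \<and> fst s' 7 = X div base S ^ (2 * cnt S (fst s' 10)) \<and>
    (\<forall>a. a < n * n + n \<or> n * n + 3 * n \<le> a \<longrightarrow> snd s' a = snd s a) \<and>
    (\<forall>i < fst s' 10. snd s' (n * n + (n + i)) = (if i \<in> S then dec_left S X i else 2 * card S + 1) \<and>
       snd s' (n * n + (n + (n + i))) = (if i \<in> S then dec_right S X i else 2 * card S + 1)))"
  let ?e = "Sub (Reg 0) (Reg 10)"
  let ?B = "Seq (If (Mem (Add (Reg 2) (Reg 10)))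
                (Seq divmod_prog (Seq (SetMem (L_addr (Reg 10)) (Reg 13))
                (Seq divmod_prog (SetMem (R_addr (Reg 10)) (Add (Mem (L_addr (Reg 10))) (Reg 13))))))
                (Seq (SetMem (L_addr (Reg 10)) (Reg 3)) (SetMem (R_addr (Reg 10)) (Reg 3))))
          (SetReg 10 (Add (Reg 10) (Const 1)))"
  have "wp (While ?e ?B) ((fst s)(10 := 0), snd s)
    (\<lambda>t s'. I s' \<and> eval ?e s' = 0 \<and> t \<le> n * (60 * X + 190 + cost ?e + 1) + cost ?e + 1)"
  proof (rule wp_mono[OF wp_While[where I = I and W = "60 * X + 190" and f = "\<lambda>s. n - fst s 10"]])
    show "I ((fst s)(10 := 0), snd s)"
      by (simp add: I_def X_def cnt_def)
    show "wp ?B s1 (\<lambda>t s'. t \<le> 60 * X + 190 \<and> I s' \<and> n - fst s' 10 < n - fst s1 10)"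
      if I: "I s1" and ne: "eval ?e s1 \<noteq> 0" for s1
    proof -
      have env1: "env n D S s1"
        using I by (intro env_frame[OF env]) (auto simp: I_def)
      define i where "i = fst s1 10"
      have r: "fst s1 0 = n" "fst s1 2 = n * n" "fst s1 3 = 2 * card S + 1" "fst s1 10 = i"
        using env1 by (auto simp: env_def i_def)
      have i: "i < n" using ne r by simp
      have mk: "snd s1 (n * n + i) = of_bool (i \<in> S)" using env1 i by (simp add: env_def)
      show ?thesis
      proof (cases "i \<in> S")
        case False
        then show ?thesis
          using I r mk i
          by (auto simp: wp_simps I_def cnt_Suc less_Suc_eq)
      next
        case True
        define x where "x = fst s1 7"
        have x: "x = X div base S ^ (2 * cnt S i)" using I by (simp add: I_def x_def i_def)
        \<comment> \<open>The simplifier brings the divisor \<open>2 * fst s1 3\<close> into this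
          form; it has to be recognised as the base.\<close>
        have b: "Suc (Suc (4 * card S)) = base S" by (simp add: base_def)
        have xle: "x \<le> X" "x div base S \<le> X" using x by (auto simp: intro: div_le_dividend le_trans)
        have dl: "x mod base S = dec_left S X i" by (simp add: x dec_left_def)
        have dr: "dec_left S X i + x div base S mod base S = dec_right S X i"
          by (simp add: x dec_right_def div_mult2_eq[symmetric] mult.commute)
        have x': "x div base S div base S = X div base S ^ (2 * cnt S (Suc i))"
          using True by (simp add: x cnt_Suc div_mult2_eq[symmetric] mult_ac)
        show ?thesis
          apply (simp only: wp_Seq wp_If)
          apply (simp add: r mk True)
          apply (rule wp_mono[OF wp_divmod])
           apply (simp add: r)
          apply (clarsimp simp: wp_simps r)
          apply (rule wp_mono[OF wp_divmod])
           apply (simp add: r)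
          apply (clarsimp simp: wp_simps r simp flip: x_def)
          apply (simp only: b dl dr x')
          using I r i True xle by (auto simp: I_def less_Suc_eq)
      qed
    qed
  qed (auto simp: algebra_simps)
  then show ?thesis
    unfolding decode_prog_def wp_Seq wp_SetReg
    apply simp
    apply (erule wp_mono)
    using S env by (auto simp: I_def X_def cnt_def Int_absorb2 env_def algebra_simps)
qed

section \<open>Extending the intervals to the vertices outside \<open>S\<close>\<close>

definition ext_left :: "nat set \<Rightarrow> (nat \<Rightarrow> nat set) \<Rightarrow> nat \<Rightarrow> (nat \<Rightarrow> nat) \<Rightarrow> (nat \<Rightarrow> nat) \<Rightarrow> nat \<Rightarrow> nat" where
  "ext_left S N P l r i = (if i \<in> S then l i else Min (insert P (r ` N i)))"

text \<open>To meet the interval of a neighbour \<open>j\<close>, an interval must start no later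
  than \<open>r j\<close> and end no earlier than \<open>l j\<close>. So right endpoints determine
  the left end in \<open>ext_left\<close>, left endpoints the right end here, and \<open>P\<close>
  keeps the common point inside.\<close>

definition ext_right :: "nat set \<Rightarrow> (nat \<Rightarrow> nat set) \<Rightarrow> nat \<Rightarrow> (nat \<Rightarrow> nat) \<Rightarrow> (nat \<Rightarrow> nat) \<Rightarrow> nat \<Rightarrow> nat" where
  "ext_right S N P l r i = (if i \<in> S then r i else Max (insert P (l ` N i)))"

text \<open>Truncated subtraction in both directions adds up to the absolute difference of row and
  column.\<close>

definition neq_expr :: expr where
  "neq_expr = Add (Sub (Reg 10) (Reg 12)) (Sub (Reg 12) (Reg 10))"

definition extend_prog :: prog where
  "extend_prog = grid
     (If (Mem (Add (Reg 2) (Reg 10))) Skip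
       (If (Mem (Add (Reg 2) (Reg 12)))
         (If (Mem (Reg 11))
           (Seq (If (Sub (Mem (L_addr (Reg 10))) (Mem (R_addr (Reg 12))))
                  (SetMem (L_addr (Reg 10)) (Mem (R_addr (Reg 12)))) Skip)
                (If (Sub (Mem (L_addr (Reg 12))) (Mem (R_addr (Reg 10))))
                  (SetMem (R_addr (Reg 10)) (Mem (L_addr (Reg 12)))) Skip))
           Skip)
         Skip))"

text \<open>The neighbourhood in \<open>S\<close> as a loop invariant needs it: only the matrix
  positions before \<open>p\<close> have been seen, and \<open>p = n * n\<close> gives all of
  it.\<close>

definition nbrs :: "nat \<Rightarrow> nat set \<Rightarrow> nat set \<Rightarrow> nat \<Rightarrow> nat \<Rightarrow> nat set" where
  "nbrs n D S p i = {j \<in> S. i * n + j \<in> D \<and> i * n + j < p}"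

lemma nbrs_Suc:
  assumes "S \<subseteq> {..<n}"
  shows "nbrs n D S (Suc p) i =
    (if i = p div n \<and> p mod n \<in> S \<and> p \<in> D then insert (p mod n) (nbrs n D S p i) else nbrs n D S p i)"
proof -
  have "i * n + j = p \<longleftrightarrow> i = p div n \<and> j = p mod n" if "j \<in> S" for j
  proof -
    have "j < n" using that assms by auto
    then show ?thesis by auto
  qed
  then have "{j \<in> S. i * n + j = p \<and> p \<in> D} =
      (if i = p div n \<and> p mod n \<in> S \<and> p \<in> D then {p mod n} else {})"
    by (simp cong: conj_cong)
  moreover have "nbrs n D S (Suc p) i = {j \<in> S. i * n + j = p \<and> p \<in> D} \<union> nbrs n D S p i"
    by (auto simp: nbrs_def less_Suc_eq)
  ultimately show ?thesis by simp
qed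

lemma finite_nbrs: "S \<subseteq> {..<n} \<Longrightarrow> finite (nbrs n D S p i)"
  by (rule finite_subset[of _ "{..<n}"]) (auto simp: nbrs_def)

text \<open>A minimum or maximum can be updated in place as its elements arrive. Only cells of
  vertices outside \<open>S\<close> change and only those of vertices in \<open>S\<close> are read
  as neighbours, so the order of the visits does not matter.\<close>

lemma wp_extend:
  assumes env: "env n D S s" and S: "S \<subseteq> {..<n}"
    and L: "\<And>i. i < n \<Longrightarrow> snd s (n * n + (n + i)) = (if i \<in> S then l i else P)"
    and R: "\<And>i. i < n \<Longrightarrow> snd s (n * n + (n + (n + i))) = (if i \<in> S then r i else P)"
  shows "wp extend_prog s (\<lambda>t s'. t \<le> 140 * (n * n + 1) \<and>
    (\<forall>x < 10. fst s' x = fst s x) \<and>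
    (\<forall>a. a < n * n + n \<or> n * n + 3 * n \<le> a \<longrightarrow> snd s' a = snd s a) \<and>
    (\<forall>i < n. snd s' (n * n + (n + i)) = ext_left S (nbrs n D S (n * n)) P l r i \<and>
       snd s' (n * n + (n + (n + i))) = ext_right S (nbrs n D S (n * n)) P l r i))"
  unfolding extend_prog_def
proof (rule wp_mono[OF wp_grid[where n = n and W = 100 and
    J = "\<lambda>p s'. (\<forall>x < 10. fst s' x = fst s x) \<and>
    (\<forall>a. a < n * n + n \<or> n * n + 3 * n \<le> a \<longrightarrow> snd s' a = snd s a) \<and>
    (\<forall>i < n. snd s' (n * n + (n + i)) = ext_left S (nbrs n D S p) P l r i \<and>
       snd s' (n * n + (n + (n + i))) = ext_right S (nbrs n D S p) P l r i)"]], goal_cases)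
  case 1
  then show ?case using env by (simp add: env_def)
next
  case 2
  then show ?case using L R by (simp add: ext_left_def ext_right_def nbrs_def)
next
  case (3 p s u v w)
  then show ?case by simp
next
  case (4 p s')
  have env': "env n D S s'"
    using 4 by (intro env_frame[OF env]) auto
  define i where "i = p div n"
  define j where "j = p mod n"
  have "n > 0" using 4(1) by (cases n) auto
  then have ij: "i < n" "j < n" using 4(1) by (auto simp: i_def j_def less_mult_imp_div_less)
  have r: "fst s' 0 = n" "fst s' 2 = n * n" "fst s' 10 = i" "fst s' 12 = j" "fst s' 11 = p"
    using env' 4 by (auto simp: env_def i_def j_def)
  have mk: "snd s' (n * n + i) = of_bool (i \<in> S)" "snd s' (n * n + j) = of_bool (j \<in> S)"
     "snd s' p = of_bool (p \<in> D)"
    using env' ij 4(1) by (auto simp: env_def)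
  note Suc = nbrs_Suc[OF S, of D p, folded i_def j_def]
  have a1: "snd s' (n * n + (n + k)) = ext_left S (nbrs n D S p) P l r k"
    "snd s' (n * n + (n + (n + k))) = ext_right S (nbrs n D S p) P l r k"
    if "k < n" for k
    using 4(2) that by auto
  show ?case
  proof (cases "i \<notin> S \<and> j \<in> S \<and> p \<in> D")
    \<comment> \<open>With \<open>i \<in> S\<close> the set \<open>nbrs\<close> may still grow, but
      the extension does not use it there.\<close>
    case False
    have "ext_left S (nbrs n D S (Suc p)) P l r k = ext_left S (nbrs n D S p) P l r k"
      "ext_right S (nbrs n D S (Suc p)) P l r k = ext_right S (nbrs n D S p) P l r k" for k
      using False by (auto simp: ext_left_def ext_right_def Suc)
    then show ?thesis using 4(2) False by (auto simp: wp_simps r mk)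
  next
    case True
    have fin: "finite (r ` nbrs n D S p i)" "finite (l ` nbrs n D S p i)"
      using finite_nbrs[OF S] by auto
    have upd: "ext_left S (nbrs n D S (Suc p)) P l r k =
       (if k = i then min (r j) (ext_left S (nbrs n D S p) P l r i) else ext_left S (nbrs n D S p) P l r k)"
      "ext_right S (nbrs n D S (Suc p)) P l r k =
       (if k = i then max (l j) (ext_right S (nbrs n D S p) P l r i) else ext_right S (nbrs n D S p) P l r k)" for k
      using True fin by (auto simp: ext_left_def ext_right_def Suc insert_commute[of P])
    have "ext_right S (nbrs n D S p) P l r j = r j" "ext_left S (nbrs n D S p) P l r j = l j" "i \<noteq> j"
      using True by (auto simp: ext_left_def ext_right_def)
    then show ?thesis using 4(2) True ij by (auto simp: wp_simps r mk upd a1)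
  qed
qed auto

section \<open>Writing the adjacency matrix of an interval graph\<close>

definition write_prog :: prog where
  "write_prog = grid
     (SetMem (Add (Reg 8) (Reg 11))
       (Sub (Const 1) (Add (Add (Sub (Mem (L_addr (Reg 10))) (Mem (R_addr (Reg 12))))
                                (Sub (Mem (L_addr (Reg 12))) (Mem (R_addr (Reg 10)))))
                           (Sub (Const 1) neq_expr))))"

definition meets :: "(nat \<Rightarrow> nat) \<Rightarrow> (nat \<Rightarrow> nat) \<Rightarrow> nat \<Rightarrow> nat \<Rightarrow> bool" where
  "meets l r i j \<longleftrightarrow> i \<noteq> j \<and> l i \<le> r j \<and> l j \<le> r i"

lemma wp_write:
  assumes env: "env n D S s"
    and O: "n * n + 3 * n \<le> fst s 8"
    and L: "\<And>i. i < n \<Longrightarrow> snd s (n * n + (n + i)) = l i"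
    and R: "\<And>i. i < n \<Longrightarrow> snd s (n * n + (n + (n + i))) = r i"
  shows "wp write_prog s (\<lambda>t s'. t \<le> 140 * (n * n + 1) \<and>
    (\<forall>x < 10. fst s' x = fst s x) \<and>
    (\<forall>a. a < fst s 8 \<longrightarrow> snd s' a = snd s a) \<and>
    (\<forall>p < n * n. snd s' (fst s 8 + p) = of_bool (meets l r (p div n) (p mod n))))"
  unfolding write_prog_def
proof (rule wp_mono[OF wp_grid[where n = n and W = 100 and
    J = "\<lambda>p s'. (\<forall>x < 10. fst s' x = fst s x) \<and>
    (\<forall>a. a < fst s 8 \<longrightarrow> snd s' a = snd s a) \<and>
    (\<forall>q < p. snd s' (fst s 8 + q) = of_bool (meets l r (q div n) (q mod n)))"]], goal_cases)
  case 1
  then show ?case using env by (simp add: env_def)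
next
  case 2
  then show ?case by simp
next
  case (3 p s u v w)
  then show ?case by simp
next
  case (4 p s')
  have env': "env n D S s'"
    using 4 O by (intro env_frame[OF env]) auto
  define i where "i = p div n"
  define j where "j = p mod n"
  have "n > 0" using 4(1) by (cases n) auto
  then have ij: "i < n" "j < n" using 4(1) by (auto simp: i_def j_def less_mult_imp_div_less)
  have r: "fst s' 0 = n" "fst s' 2 = n * n" "fst s' 10 = i" "fst s' 12 = j" "fst s' 11 = p" "fst s' 8 = fst s 8"
    using env' 4 by (auto simp: env_def i_def j_def)
  have "n * n + (n + k) < fst s 8" "n * n + (n + (n + k)) < fst s 8" if "k < n" for k
    using O that by auto
  then have a1: "snd s' (n * n + (n + k)) = l k" "snd s' (n * n + (n + (n + k))) = r k" if "k < n" for k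
    using 4(2) that L R by auto
  show ?case
    using 4(2) ij by (auto simp: wp_simps r a1 neq_expr_def meets_def less_Suc_eq simp flip: i_def j_def)
qed auto

text \<open>The candidate \<open>c\<close> is cut into blocks of \<open>2 * card S\<close> digits;
  the division drops the blocks before block \<open>t\<close>.\<close>

definition cand_left :: "nat \<Rightarrow> nat set \<Rightarrow> nat set \<Rightarrow> nat \<Rightarrow> nat \<Rightarrow> nat \<Rightarrow> nat" where
  "cand_left n D S c t = ext_left S (nbrs n D S (n * n)) (2 * card S + 1)
     (dec_left S (c div base S ^ (2 * card S * t))) (dec_right S (c div base S ^ (2 * card S * t)))"

definition cand_right :: "nat \<Rightarrow> nat set \<Rightarrow> nat set \<Rightarrow> nat \<Rightarrow> nat \<Rightarrow> nat \<Rightarrow> nat" where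
  "cand_right n D S c t = ext_right S (nbrs n D S (n * n)) (2 * card S + 1)
     (dec_left S (c div base S ^ (2 * card S * t))) (dec_right S (c div base S ^ (2 * card S * t)))"

definition build_prog :: prog where
  "build_prog =
    Seq (SetReg 7 (Reg 4)) (Seq (SetReg 8 (Reg 1)) (Seq (SetReg 9 (Const 0))
      (While (Sub (Reg 5) (Reg 9))
        (Seq decode_prog (Seq extend_prog (Seq write_prog
          (Seq (SetReg 8 (Add (Reg 8) (Reg 2))) (SetReg 9 (Add (Reg 9) (Const 1))))))))))"

text \<open>Register 7 ends with what is left after all blocks are read. It is nonzero exactly if
  \<open>c\<close> is too large for the current dimension, which tells the search when to move
  on.\<close>

lemma wp_build:
  assumes env: "env n D S s" and S: "S \<subseteq> {..<n}"
  shows "wp build_prog s (\<lambda>t s'. t \<le> fst s 5 * (n * (60 * fst s 4 + 200) + 280 * (n * n + 1) + 40) + 20 \<and>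
    (\<forall>x < 7. fst s' x = fst s x) \<and> fst s' 7 = fst s 4 div base S ^ (2 * card S * fst s 5) \<and>
    env n D S s' \<and>
    (\<forall>t < fst s 5. \<forall>p < n * n. snd s' (n * n + 3 * n + t * (n * n) + p) =
       of_bool (meets (cand_left n D S (fst s 4) t) (cand_right n D S (fst s 4) t) (p div n) (p mod n))))"
proof -
  define c where "c = fst s 4"
  define d where "d = fst s 5"
  define I where "I = (\<lambda>s'. fst s' 9 \<le> d \<and> (\<forall>x < 7. fst s' x = fst s x) \<and>
    fst s' 7 = c div base S ^ (2 * card S * fst s' 9) \<and>
    fst s' 8 = n * n + 3 * n + fst s' 9 * (n * n) \<and>
    env n D S s' \<and>
    (\<forall>t < fst s' 9. \<forall>p < n * n. snd s' (n * n + 3 * n + t * (n * n) + p) =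
       of_bool (meets (cand_left n D S c t) (cand_right n D S c t) (p div n) (p mod n))))"
  let ?e = "Sub (Reg 5) (Reg 9)"
  let ?B = "Seq decode_prog (Seq extend_prog (Seq write_prog
          (Seq (SetReg 8 (Add (Reg 8) (Reg 2))) (SetReg 9 (Add (Reg 9) (Const 1))))))"
  let ?W = "n * (60 * c + 200) + 280 * (n * n + 1) + 36"
  let ?s0 = "((fst s)(7 := c, 8 := fst s 1, 9 := 0), snd s)"
  have "wp (While ?e ?B) ?s0
    (\<lambda>t s'. I s' \<and> eval ?e s' = 0 \<and> t \<le> d * (?W + cost ?e + 1) + cost ?e + 1)"
  proof (rule wp_mono[OF wp_While[where I = I and W = "?W" and f = "\<lambda>s. d - fst s 9"]])
    show "I ?s0"
      using env by (auto simp: I_def env_def)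
    show "wp ?B s1 (\<lambda>t s'. t \<le> ?W \<and> I s' \<and> d - fst s' 9 < d - fst s1 9)"
      if I: "I s1" and ne: "eval ?e s1 \<noteq> 0" for s1
    proof -
      define k where "k = fst s1 9"
      define X where "X = c div base S ^ (2 * card S * k)"
      have X: "fst s1 7 = X" "X \<le> c" using I by (auto simp: I_def X_def k_def)
      have env1: "env n D S s1" using I by (simp add: I_def)
      have kd: "k < d" using I ne by (simp add: I_def k_def d_def)
      show ?thesis
        unfolding wp_Seq
      proof (rule wp_mono[OF wp_decode[OF env1 S]], goal_cases)
        case (1 t2 s2)
        have env2: "env n D S s2"
          using 1 by (intro env_frame[OF env1]) auto
        show ?case
        proof (rule wp_mono[OF wp_extend[OF env2 S, where l = "dec_left S X" and r = "dec_right S X" and P = "2 * card S + 1"]], goal_cases)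
          case 1 then show ?case using \<open>t2 \<le> _ \<and> _\<close> X by auto
        next
          case 2 then show ?case using \<open>t2 \<le> _ \<and> _\<close> X by auto
        next
          case (3 t3 s3)
          have env3: "env n D S s3"
            using 3 by (intro env_frame[OF env2]) auto
          have 8: "fst s3 8 = n * n + 3 * n + k * (n * n)"
            using I 1 3 by (auto simp: I_def k_def)
          show ?case
          proof (rule wp_mono[OF wp_write[OF env3, where l = "cand_left n D S c k" and r = "cand_right n D S c k"]], goal_cases)
            case 1 then show ?case by (simp add: 8)
          next
            case 2 then show ?case using 3 by (auto simp: cand_left_def X_def)
          next
            case 3 then show ?case using \<open>t3 \<le> _ \<and> _\<close> by (auto simp: cand_right_def X_def)
          next
            case (4 t4 s4)
            have env4: "env n D S s4"
              using 4 8 by (intro env_frame[OF env3]) auto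
            have regs: "fst s4 x = fst s1 x" if "x < 10" "x \<noteq> 7" for x
              using 1 3 4 that by auto
            have 7: "fst s4 7 = c div base S ^ (2 * card S * Suc k)"
            proof -
              have "fst s4 7 = X div base S ^ (2 * card S)" using 1 3 4 X by auto
              then show ?thesis
                by (simp add: X_def div_mult2_eq[symmetric] power_add[symmetric] add.commute)
            qed
            have mem: "snd s4 (n * n + 3 * n + t * (n * n) + p) =
               of_bool (meets (cand_left n D S c t) (cand_right n D S c t) (p div n) (p mod n))"
              if "t < Suc k" "p < n * n" for t p
            proof (cases "t = k")
              case True
              then show ?thesis using 4 that by (simp add: 8)
            next
              case False
              \<comment> \<open>An earlier matrix ends before the current output address, hence is
                not overwritten.\<close>
              then have "Suc t * (n * n) \<le> k * (n * n)" using that by (intro mult_le_mono1) simp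
              then have "n * n + 3 * n + t * (n * n) + p < fst s3 8"
                using that by (simp add: 8)
              then have "snd s4 (n * n + 3 * n + t * (n * n) + p) = snd s1 (n * n + 3 * n + t * (n * n) + p)"
                using 1 3 4 by auto
              then show ?thesis using I that False by (auto simp: I_def k_def)
            qed
            have "t2 + t3 + t4 + 8 \<le> ?W"
            proof -
              have "t2 \<le> n * (60 * c + 200) + 10"
                using 1 X by (meson add_le_mono1 add_le_mono le_refl le_trans mult_le_mono2)
              then show ?thesis using 3 4 by simp
            qed
            moreover have "env n D S ((fst s4)(8 := u, 9 := v), snd s4)" for u v
              using env4 by (simp add: env_def)
            moreover have "fst s4 2 = n * n" using env4 by (simp add: env_def)
            ultimately show ?case
              using 7 mem kd I regs by (auto simp: wp_simps I_def k_def algebra_simps)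
          qed
        qed
      qed
    qed
  qed auto
  then show ?thesis
    unfolding build_prog_def wp_Seq wp_SetReg
    apply (simp add: c_def)
    apply (erule wp_mono)
    using env by (auto simp: I_def c_def d_def)
qed

section \<open>Comparing the intersection with the input graph\<close>

definition conj_prog :: prog where
  "conj_prog =
    Seq (SetReg 14 (Const 1)) (Seq (SetReg 15 (Add (Reg 1) (Reg 11))) (Seq (SetReg 9 (Const 0))
      (While (Sub (Reg 5) (Reg 9))
        (Seq (SetReg 14 (Sub (Reg 14) (Sub (Const 1) (Mem (Reg 15)))))
        (Seq (SetReg 15 (Add (Reg 15) (Reg 2))) (SetReg 9 (Add (Reg 9) (Const 1))))))))"

text \<open>Register 14 starts at 1 and loses 1 for each zero entry; truncation keeps it at 0, so it
  computes a conjunction. Register 15 walks through the same position of the consecutive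
  matrices.\<close>

lemma wp_conj:
  "wp conj_prog s (\<lambda>t s'. t \<le> 40 * (fst s 5 + 1) \<and> snd s' = snd s \<and>
     (\<forall>x. x \<notin> {9, 14, 15} \<longrightarrow> fst s' x = fst s x) \<and>
     fst s' 14 = of_bool (\<forall>t < fst s 5. snd s (fst s 1 + fst s 11 + t * fst s 2) \<noteq> 0))"
proof -
  define I where "I = (\<lambda>s'. snd s' = snd s \<and>
     (\<forall>x. x \<notin> {9, 14, 15} \<longrightarrow> fst s' x = fst s x) \<and>
     fst s' 9 \<le> fst s 5 \<and> fst s' 15 = fst s 1 + fst s 11 + fst s' 9 * fst s 2 \<and>
     fst s' 14 = of_bool (\<forall>t < fst s' 9. snd s (fst s 1 + fst s 11 + t * fst s 2) \<noteq> 0))"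
  let ?e = "Sub (Reg 5) (Reg 9)"
  let ?B = "Seq (SetReg 14 (Sub (Reg 14) (Sub (Const 1) (Mem (Reg 15)))))
        (Seq (SetReg 15 (Add (Reg 15) (Reg 2))) (SetReg 9 (Add (Reg 9) (Const 1))))"
  let ?s0 = "((fst s)(14 := 1, 15 := fst s 1 + fst s 11, 9 := 0), snd s)"
  have "wp (While ?e ?B) ?s0
    (\<lambda>t s'. I s' \<and> eval ?e s' = 0 \<and> t \<le> fst s 5 * (20 + cost ?e + 1) + cost ?e + 1)"
  proof (rule wp_mono[OF wp_While[where I = I and W = 20 and f = "\<lambda>s'. fst s 5 - fst s' 9"]])
    show "I ?s0" by (simp add: I_def)
    show "wp ?B s1 (\<lambda>t s'. t \<le> 20 \<and> I s' \<and> fst s 5 - fst s' 9 < fst s 5 - fst s1 9)"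
      if I: "I s1" and ne: "eval ?e s1 \<noteq> 0" for s1
      using that by (auto simp: wp_simps I_def less_Suc_eq algebra_simps)
  qed auto
  then show ?thesis
    unfolding conj_prog_def wp_Seq wp_SetReg
    apply (simp split del: split_of_bool)
    apply (erule wp_mono)
    by (auto simp: I_def)
qed

text \<open>The diagonal has to be skipped: in dimension 0 the empty conjunction is true there,
  whereas the input matrix has zeros.\<close>

definition check_prog :: prog where
  "check_prog =
    Seq (SetReg 6 (Const 1)) (grid
      (Seq conj_prog
        (If neq_expr
          (If (Add (Sub (Reg 14) (Mem (Reg 11))) (Sub (Mem (Reg 11)) (Reg 14)))
            (SetReg 6 (Const 0)) Skip)
          Skip)))"

lemma wp_check:
  assumes env: "env n D S s" and d: "fst s 5 = d"
    and M: "\<And>t p. t < d \<Longrightarrow> p < n * n \<Longrightarrow>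
      snd s (n * n + 3 * n + t * (n * n) + p) = of_bool (adj t (p div n) (p mod n))"
  shows "wp check_prog s (\<lambda>t s'. t \<le> (120 + 40 * d) * (n * n + 1) + 2 \<and> snd s' = snd s \<and>
    (\<forall>x < 9. x \<noteq> 6 \<longrightarrow> fst s' x = fst s x) \<and>
    fst s' 6 = of_bool (\<forall>p < n * n. p div n \<noteq> p mod n \<longrightarrow>
      (p \<in> D \<longleftrightarrow> (\<forall>t < d. adj t (p div n) (p mod n)))))"
proof -
  let ?good = "\<lambda>p. p div n \<noteq> p mod n \<longrightarrow> (p \<in> D \<longleftrightarrow> (\<forall>t < d. adj t (p div n) (p mod n)))"
  define J where "J = (\<lambda>p s'. snd s' = snd s \<and> (\<forall>x < 9. x \<noteq> 6 \<longrightarrow> fst s' x = fst s x) \<and>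
    fst s' 6 = of_bool (\<forall>q < p. ?good q))"
  show ?thesis
    unfolding check_prog_def wp_Seq wp_SetReg
  proof (rule wp_mono[OF wp_grid[where n = n and W = "80 + 40 * d" and J = J]], goal_cases)
    case 1
    then show ?case using env by (simp add: env_def)
  next
    case 2
    then show ?case by (simp add: J_def)
  next
    case (3 p s u v w)
    then show ?case by (simp add: J_def)
  next
    case (4 p s')
    have env': "env n D S s'"
      using 4 by (intro env_frame[OF env]) (auto simp: J_def)
    have r: "fst s' 1 = n * n + 3 * n" "fst s' 2 = n * n" "snd s' p = of_bool (p \<in> D)" "fst s' 5 = d"
      using env' 4 d by (auto simp: env_def J_def)
    have M': "snd s' (n * n + 3 * n + p + t * (n * n)) = of_bool (adj t (p div n) (p mod n))"
      if "t < d" for t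
      using 4 M[OF that 4(1)] by (simp add: J_def add_ac)
    show ?case
      unfolding wp_Seq
    proof (rule wp_mono[OF wp_conj], goal_cases)
      case (1 t s2)
      then have "fst s2 14 = of_bool (\<forall>t < d. adj t (p div n) (p mod n))"
        using M' r 4 by (auto simp: of_bool_def)
      then show ?case
        using 1 4 r by (auto simp: wp_simps neq_expr_def J_def less_Suc_eq)
    qed
  next
    case (5 t s')
    then show ?case by (auto simp: J_def)
  qed
qed

section \<open>Exhaustive search over dimensions and candidates\<close>

definition good_cand :: "nat \<Rightarrow> nat set \<Rightarrow> nat set \<Rightarrow> nat \<Rightarrow> nat \<Rightarrow> bool" where
  "good_cand n D S d c \<longleftrightarrow> (\<forall>p < n * n. p div n \<noteq> p mod n \<longrightarrow>
     (p \<in> D \<longleftrightarrow> (\<forall>t < d. meets (cand_left n D S c t) (cand_right n D S c t) (p div n) (p mod n))))"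

definition outputs_cand :: "nat \<Rightarrow> nat set \<Rightarrow> nat set \<Rightarrow> nat \<Rightarrow> nat \<Rightarrow> state \<Rightarrow> bool" where
  "outputs_cand n D S d c s \<longleftrightarrow> (\<forall>t < d. \<forall>p < n * n. snd s (n * n + 3 * n + t * (n * n) + p) =
     of_bool (meets (cand_left n D S c t) (cand_right n D S c t) (p div n) (p mod n)))"

definition search_prog :: prog where
  "search_prog =
    While (Sub (Const 1) (Reg 6))
      (Seq build_prog (Seq check_prog
        (If (Reg 6) Skip
          (If (Reg 7)
            (Seq (SetReg 5 (Add (Reg 5) (Const 1))) (SetReg 4 (Const 0)))
            (SetReg 4 (Add (Reg 4) (Const 1)))))))"

definition step_bound :: "nat \<Rightarrow> nat \<Rightarrow> nat \<Rightarrow> nat" where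
  "step_bound n b K =
     b * (n * (60 * K + 200) + 280 * (n * n + 1) + 40) + (120 + 40 * b) * (n * n + 1) + 50"

lemma step_bound_mono: "d \<le> b \<Longrightarrow> c \<le> K \<Longrightarrow> step_bound n d c \<le> step_bound n b K"
  unfolding step_bound_def by (intro add_mono mult_mono) auto

text \<open>The first factor bounds the rounds: besides at most \<open>K\<close> genuine candidates,
  each dimension up to \<open>b\<close> may also try the first number out of range, whose nonzero
  rest in register 7 raises the dimension.\<close>

definition search_bound :: "nat \<Rightarrow> nat \<Rightarrow> nat \<Rightarrow> nat" where
  "search_bound n b K = (b * (K + 2) + K + 2) * (step_bound n b K + 4) + 4"

text \<open>Dimensions are tried in increasing order. By \<open>least\<close> no smaller one
  succeeds, and by \<open>ex\<close> dimension \<open>b\<close> does so within its range, hence the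
  search halts exactly there.\<close>

lemma wp_search:
  assumes env: "env n D S s" and S: "S \<subseteq> {..<n}"
    and init: "fst s 4 = 0" "fst s 5 = 0" "fst s 6 = 0"
    and ex: "\<exists>c < base S ^ (2 * card S * b). good_cand n D S b c"
    and least: "\<And>d c. d < b \<Longrightarrow> \<not> good_cand n D S d c"
  shows "wp search_prog s (\<lambda>t s'. t \<le> search_bound n b (base S ^ (2 * card S * b)) \<and>
    env n D S s' \<and> fst s' 5 = b \<and> (\<exists>c. good_cand n D S b c \<and> outputs_cand n D S b c s'))"
proof -
  define K where "K = base S ^ (2 * card S * b)"
  define I where "I = (\<lambda>s. env n D S s \<and> fst s 5 \<le> b \<and>
    (if fst s 6 = 0 then fst s 4 \<le> base S ^ (2 * card S * fst s 5) \<and>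
        (\<forall>c < fst s 4. \<not> good_cand n D S (fst s 5) c)
     else good_cand n D S (fst s 5) (fst s 4) \<and> outputs_cand n D S (fst s 5) (fst s 4) s))"
  \<comment> \<open>A lexicographic measure: raising the dimension frees \<open>K + 2\<close>,
    enough to pay for resetting the candidate to 0. The final 1 keeps it above 0, the value reserved
    for success.\<close>
  define g where "g = (\<lambda>d c. (b - d) * (K + 2) + (K + 1 - c) + 1)"
  define f where "f = (\<lambda>s :: state. if fst s 6 = 0 then g (fst s 5) (fst s 4) else 0)"
  have base: "base S > 0" by (simp add: base_def)
  have f0: "f s = b * (K + 2) + K + 2" using init by (simp add: f_def g_def)
  have KK: "base S ^ (2 * card S * d) \<le> K" if "d \<le> b" for d
    unfolding K_def using base that by (intro power_increasing) auto
  show ?thesis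
    unfolding search_prog_def search_bound_def K_def[symmetric] f0[symmetric]
  proof (rule wp_mono[OF wp_While[where I = I and f = f and W = "step_bound n b K"]])
    show "I s" using env init base by (simp add: I_def)
  next
    fix s1 assume I: "I s1" and "eval (Sub (Const 1) (Reg 6)) s1 \<noteq> 0"
    then have 6: "fst s1 6 = 0" by simp
    define c where "c = fst s1 4"
    define d where "d = fst s1 5"
    have env1: "env n D S s1" and db: "d \<le> b" and cle: "c \<le> base S ^ (2 * card S * d)"
      and bad: "\<And>c'. c' < c \<Longrightarrow> \<not> good_cand n D S d c'"
      using I 6 by (auto simp: I_def c_def d_def)
    have cK: "c \<le> K" using cle KK[OF db] by simp
    have W: "step_bound n d c \<le> step_bound n b K"
      using db cK by (rule step_bound_mono)
    show "wp (Seq build_prog (Seq check_prog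
        (If (Reg 6) Skip
          (If (Reg 7)
            (Seq (SetReg 5 (Add (Reg 5) (Const 1))) (SetReg 4 (Const 0)))
            (SetReg 4 (Add (Reg 4) (Const 1))))))) s1
       (\<lambda>t s'. t \<le> step_bound n b K \<and> I s' \<and> f s' < f s1)"
      unfolding wp_Seq
    proof (rule wp_mono[OF wp_build[OF env1 S]], goal_cases)
      case (1 t2 s2)
      note b2 = 1[folded c_def d_def]
      have env2: "env n D S s2" using b2 by simp
      have out2: "outputs_cand n D S d c s2" using b2 by (simp add: outputs_cand_def)
      show ?case
      proof (rule wp_mono[OF wp_check[OF env2, where d = d and
            adj = "\<lambda>t. meets (cand_left n D S c t) (cand_right n D S c t)"]], goal_cases)
        case 1
        then show ?case using b2 by (simp add: d_def)
      next
        case (2 t p)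
        then show ?case using b2 by simp
      next
        case (3 t3 s3)
        note c3 = 3[folded good_cand_def]
        have env3: "env n D S s3" using c3 by (intro env_frame[OF env2]) auto
        have r3: "fst s3 4 = c" "fst s3 5 = d" "fst s3 7 = c div base S ^ (2 * card S * d)"
          using c3 b2 by (auto simp: c_def d_def)
        have out3: "outputs_cand n D S d c s3" using out2 c3 by (simp add: outputs_cand_def)
        have t: "t2 + t3 + 28 \<le> step_bound n b K"
          using c3 b2 W by (simp add: step_bound_def)
        have envu: "env n D S ((fst s3)(4 := u), snd s3)" "env n D S ((fst s3)(5 := v, 4 := u), snd s3)" for u v
          using env3 by (auto simp: env_def)
        show ?case
        proof (cases "good_cand n D S d c")
          case True
          then show ?thesis
            using c3 out3 env3 r3 db 6 t by (auto simp: wp_simps I_def f_def g_def)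
        next
          case False
          then have nf: "fst s3 6 = 0" using c3 by (simp add: good_cand_def)
          have bad': "\<And>c'. c' < Suc c \<Longrightarrow> \<not> good_cand n D S d c'"
            using bad False by (auto simp: less_Suc_eq)
          show ?thesis
          proof (cases "c < base S ^ (2 * card S * d)")
            case True
            have "g d (Suc c) < g d c"
              using cK by (simp add: g_def)
            then show ?thesis
              using True 6 nf r3 envu(1) db t bad'
              by (simp add: wp_simps I_def f_def flip: c_def d_def)
          next
            case False
            then have "c div base S ^ (2 * card S * d) \<noteq> 0"
              using base by (simp add: div_greater_zero_iff)
            \<comment> \<open>All numbers in the range of dimension \<open>d\<close> have failed,
              which \<open>ex\<close> rules out for \<open>d = b\<close>.\<close>
            moreover have "d \<noteq> b" using ex bad False by auto
            then have "d < b" using db by simp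
            moreover have "g (Suc d) 0 < g d c"
            proof -
              have "b - d = Suc (b - Suc d)" using \<open>d < b\<close> by simp
              then show ?thesis using cK by (simp add: g_def)
            qed
            ultimately show ?thesis
              using 6 nf r3 envu(2) t
              by (simp add: wp_simps I_def f_def flip: c_def d_def)
          qed
        qed
      qed
    qed
  next
    fix t s' assume a: "I s' \<and> eval (Sub (Const 1) (Reg 6)) s' = 0 \<and>
      t \<le> f s * (step_bound n b K + cost (Sub (Const 1) (Reg 6)) + 1) + cost (Sub (Const 1) (Reg 6)) + 1"
    then have "fst s' 6 \<noteq> 0" by simp
    moreover from this have "fst s' 5 = b"
      using a least[of "fst s' 5"] by (force simp: I_def)
    ultimately show "t \<le> f s * (step_bound n b K + 4) + 4 \<and> env n D S s' \<and> fst s' 5 = b \<and>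
        (\<exists>c. good_cand n D S b c \<and> outputs_cand n D S b c s')"
      using a by (auto simp: I_def add_mult_distrib2)
  qed
qed

section \<open>A greedy matching in the complement graph\<close>

definition match_prog :: prog where
  "match_prog = grid
     (If (Add (Add (Mem (Add (Reg 2) (Reg 10))) (Mem (Add (Reg 2) (Reg 12))))
              (Add (Mem (Reg 11)) (Sub (Const 1) neq_expr)))
       Skip
       (Seq (SetMem (Add (Reg 2) (Reg 10)) (Const 1))
       (Seq (SetMem (Add (Reg 2) (Reg 12)) (Const 1))
            (SetReg 3 (Add (Reg 3) (Const 4))))))"

text \<open>For \<open>p = n * n\<close>, \<open>S\<close> is a vertex cover of the complement
  graph, that is, the vertices outside \<open>S\<close> form a clique.\<close>

definition covers :: "nat \<Rightarrow> nat set \<Rightarrow> nat \<Rightarrow> nat set \<Rightarrow> bool" where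
  "covers n D p S \<longleftrightarrow> (\<forall>q < p. q div n \<noteq> q mod n \<longrightarrow> q \<notin> D \<longrightarrow> q div n \<in> S \<or> q mod n \<in> S)"

text \<open>Each matched pair is a non-edge, so the cover \<open>A\<close> contains one of its two
  vertices. The pairs are disjoint, hence at least half of \<open>S\<close> lies in
  \<open>A\<close>, while maximality leaves no non-edge uncovered.\<close>

lemma wp_match:
  assumes r: "fst s 0 = n" "fst s 2 = n * n" "fst s 3 = 1"
    and mem: "\<And>a. a < n * n \<Longrightarrow> snd s a = of_bool (a \<in> D)" "\<And>i. i < n \<Longrightarrow> snd s (n * n + i) = 0"
    and A: "covers n D (n * n) A"
  shows "wp match_prog s (\<lambda>t s'. t \<le> 140 * (n * n + 1) \<and>
    (\<forall>x < 10. x \<noteq> 3 \<longrightarrow> fst s' x = fst s x) \<and>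
    (\<exists>S \<subseteq> {..<n}. covers n D (n * n) S \<and> card S \<le> 2 * card (S \<inter> A) \<and>
      fst s' 3 = 2 * card S + 1 \<and> (\<forall>a < n * n. snd s' a = of_bool (a \<in> D)) \<and>
      (\<forall>i < n. snd s' (n * n + i) = of_bool (i \<in> S))))"
proof -
  define J where "J = (\<lambda>p (s' :: state). (\<forall>x < 10. x \<noteq> 3 \<longrightarrow> fst s' x = fst s x) \<and>
    (\<exists>S \<subseteq> {..<n}. covers n D p S \<and> card S \<le> 2 * card (S \<inter> A) \<and>
      fst s' 3 = 2 * card S + 1 \<and> (\<forall>a < n * n. snd s' a = of_bool (a \<in> D)) \<and>
      (\<forall>i < n. snd s' (n * n + i) = of_bool (i \<in> S))))"
  show ?thesis
    unfolding match_prog_def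
  proof (rule wp_mono[OF wp_grid[where n = n and W = 100 and J = J]], goal_cases)
    case 1
    then show ?case using r by simp
  next
    case 2
    then show ?case using r mem by (auto simp: J_def covers_def intro!: exI[of _ "{}"])
  next
    case (3 p s u v w)
    then show ?case by (simp add: J_def)
  next
    case (4 p s')
    define i where "i = p div n"
    define j where "j = p mod n"
    have "n > 0" using 4(1) by (cases n) auto
    then have ij: "i < n" "j < n" using 4(1) by (auto simp: i_def j_def less_mult_imp_div_less)
    from 4(2) obtain S where S: "S \<subseteq> {..<n}" "covers n D p S" "card S \<le> 2 * card (S \<inter> A)"
      "fst s' 3 = 2 * card S + 1" "\<And>a. a < n * n \<Longrightarrow> snd s' a = of_bool (a \<in> D)"
      "\<And>i. i < n \<Longrightarrow> snd s' (n * n + i) = of_bool (i \<in> S)"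
      and regs: "\<And>x. x < 10 \<Longrightarrow> x \<noteq> 3 \<Longrightarrow> fst s' x = fst s x" unfolding J_def by blast
    have rr: "fst s' 0 = n" "fst s' 2 = n * n" "fst s' 10 = i" "fst s' 12 = j" "fst s' 11 = p"
      using 4 r regs[of 2] by (auto simp: i_def j_def)
    note mk = S(6)[OF ij(1)] S(6)[OF ij(2)] S(5)[OF 4(1)]
    show ?case
    proof (cases "i \<in> S \<or> j \<in> S \<or> p \<in> D \<or> i = j")
      case True
      then have "covers n D (Suc p) S"
        using S(2) by (auto simp: covers_def less_Suc_eq i_def j_def)
      then have "J (Suc p) s'"
        unfolding J_def using S regs by blast
      moreover have "eval (Add (Add (Mem (Add (Reg 2) (Reg 10))) (Mem (Add (Reg 2) (Reg 12))))
                (Add (Mem (Reg 11)) (Sub (Const 1) neq_expr))) s' \<noteq> 0"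
        using True by (auto simp: rr mk neq_expr_def)
      ultimately show ?thesis
        unfolding wp_If by (simp add: wp_simps neq_expr_def)
    next
      case False
      define S' where "S' = insert i (insert j S)"
      have fin: "finite S" using S(1) finite_subset by blast
      have card: "card S' = card S + 2" using False fin by (simp add: S'_def)
      have cov: "covers n D (Suc p) S'"
        using S(2) by (auto simp: covers_def less_Suc_eq i_def j_def S'_def)
      have "i \<in> A \<or> j \<in> A"
        using A 4(1) False by (auto simp: covers_def i_def j_def)
      then have "card (insert (if i \<in> A then i else j) (S \<inter> A)) \<le> card (S' \<inter> A)"
        using fin by (intro card_mono) (auto simp: S'_def)
      then have "card S' \<le> 2 * card (S' \<inter> A)"
        using False fin S(3) by (simp add: card split: if_splits)
      \<comment> \<open>Two new vertices raise \<open>2 * card S + 1\<close> by 4.\<close>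
      then have "J (Suc p) ((fst s')(3 := fst s' 3 + 4), (snd s')(n * n + i := 1, n * n + j := 1))"
        unfolding J_def using S regs ij cov card
        by (intro conjI exI[of _ S']) (auto simp: S'_def)
      moreover have "eval (Add (Add (Mem (Add (Reg 2) (Reg 10))) (Mem (Add (Reg 2) (Reg 12))))
                (Add (Mem (Reg 11)) (Sub (Const 1) neq_expr))) s' = 0"
        using False by (auto simp: rr mk neq_expr_def)
      ultimately show ?thesis
        unfolding wp_If
        by (simp add: wp_simps rr neq_expr_def)
    qed
  next
    case (5 t s')
    then show ?case by (simp add: J_def)
  qed
qed

section \<open>The complete program\<close>

definition square_prog :: prog where
  "square_prog =
    Seq (SetReg 10 (Reg 0))
      (While (Reg 10)
        (Seq (SetReg 2 (Add (Reg 2) (Reg 0))) (SetReg 10 (Sub (Reg 10) (Const 1)))))"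

lemma wp_square:
  assumes "fst s 2 = 0"
  shows "wp square_prog s (\<lambda>t s'. t \<le> 12 * fst s 0 + 10 \<and> snd s' = snd s \<and>
    (\<forall>x < 10. fst s' x = (if x = 2 then fst s 0 * fst s 0 else fst s x)))"
proof -
  define n where "n = fst s 0"
  define I where "I = (\<lambda>s'. snd s' = snd s \<and> (\<forall>x < 10. x \<noteq> 2 \<longrightarrow> fst s' x = fst s x) \<and>
    fst s' 2 + fst s' 10 * n = n * n)"
  let ?B = "Seq (SetReg 2 (Add (Reg 2) (Reg 0))) (SetReg 10 (Sub (Reg 10) (Const 1)))"
  have "wp (While (Reg 10) ?B) ((fst s)(10 := n), snd s)
    (\<lambda>t s'. I s' \<and> eval (Reg 10) s' = 0 \<and> t \<le> n * (10 + cost (Reg 10) + 1) + cost (Reg 10) + 1)"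
  proof (rule wp_mono[OF wp_While[where I = I and W = 10 and f = "\<lambda>s. fst s 10"]])
    show "I ((fst s)(10 := n), snd s)" using assms by (simp add: I_def)
    show "wp ?B s' (\<lambda>t s''. t \<le> 10 \<and> I s'' \<and> fst s'' 10 < fst s' 10)"
      if I: "I s'" and ne: "eval (Reg 10) s' \<noteq> 0" for s'
    proof -
      obtain k where k: "fst s' 10 = Suc k" using ne by (cases "fst s' 10") auto
      show ?thesis using I by (auto simp: wp_simps I_def k n_def)
    qed
  qed auto
  then show ?thesis
    unfolding square_prog_def wp_Seq wp_SetReg
    apply (simp add: n_def)
    apply (erule wp_mono)
    by (auto simp: I_def n_def)
qed

definition box_prog :: prog where
  "box_prog =
    Seq square_prog (Seq (SetReg 3 (Const 1)) (Seq match_prog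
      (Seq (SetReg 1 (Add (Reg 2) (Add (Reg 0) (Add (Reg 0) (Reg 0)))))
      (Seq search_prog (SetReg 0 (Reg 5))))))"

definition box_prog_bound :: "nat \<Rightarrow> nat \<Rightarrow> nat \<Rightarrow> nat" where
  "box_prog_bound n b K = search_bound n b K + 140 * (n * n + 1) + 12 * n + 40"

lemma search_bound_mono: "K \<le> K' \<Longrightarrow> search_bound n b K \<le> search_bound n b K'"
  unfolding search_bound_def by (intro add_mono mult_mono step_bound_mono) auto

text \<open>The cover \<open>S\<close> is chosen at run time, so \<open>ex\<close> and
  \<open>least\<close> are assumed for every cover. The program never sees \<open>A\<close>, which
  bounds the size of \<open>S\<close> and thereby the number of candidates.\<close>

lemma wp_box_prog:
  assumes s: "fst s = (\<lambda>x. if x = 0 then n else 0)" "snd s = (\<lambda>a. of_bool (a < n * n \<and> a \<in> D))"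
    and A: "covers n D (n * n) A" "finite A"
    and ex: "\<And>S. S \<subseteq> {..<n} \<Longrightarrow> covers n D (n * n) S \<Longrightarrow> \<exists>c < base S ^ (2 * card S * b). good_cand n D S b c"
    and least: "\<And>S d c. S \<subseteq> {..<n} \<Longrightarrow> covers n D (n * n) S \<Longrightarrow> d < b \<Longrightarrow> \<not> good_cand n D S d c"
  shows "wp box_prog s (\<lambda>t s'. t \<le> box_prog_bound n b ((8 * card A + 2) ^ (4 * card A * b)) \<and>
    fst s' 0 = b \<and> fst s' 1 = n * n + 3 * n \<and>
    (\<exists>S c. S \<subseteq> {..<n} \<and> covers n D (n * n) S \<and> good_cand n D S b c \<and> outputs_cand n D S b c s'))"
  unfolding box_prog_def wp_Seq
proof (rule wp_mono[OF wp_square], goal_cases)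
  case 1
  then show ?case using s by simp
next
  case (2 t1 s1)
  show ?case
    unfolding wp_SetReg
  proof (rule wp_mono[OF wp_match[where n = n and D = D and A = A]], goal_cases)
    case (7 t2 s2)
    then obtain S where S: "S \<subseteq> {..<n}" "covers n D (n * n) S" "card S \<le> 2 * card (S \<inter> A)"
      "fst s2 3 = 2 * card S + 1" "\<And>a. a < n * n \<Longrightarrow> snd s2 a = of_bool (a \<in> D)"
      "\<And>i. i < n \<Longrightarrow> snd s2 (n * n + i) = of_bool (i \<in> S)"
      by blast
    have regs: "fst s2 0 = n" "fst s2 2 = n * n" "fst s2 4 = 0" "fst s2 5 = 0" "fst s2 6 = 0"
      using 2 7 s by auto
    let ?s3 = "((fst s2)(1 := n * n + 3 * n), snd s2)"
    have env: "env n D S ?s3"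
      using S regs by (auto simp: env_def)
    have card: "card S \<le> 2 * card A"
      using S(3) card_mono[of A "S \<inter> A"] A(2) by simp
    \<comment> \<open>With \<open>card S \<le> 2 * card A\<close> the base
      \<open>4 * card S + 2\<close> is at most \<open>8 * card A + 2\<close>.\<close>
    have K: "base S ^ (2 * card S * b) \<le> (8 * card A + 2) ^ (4 * card A * b)"
    proof -
      have "base S ^ (2 * card S * b) \<le> (8 * card A + 2) ^ (2 * card S * b)"
        using card by (intro power_mono) (auto simp: base_def)
      also have "\<dots> \<le> (8 * card A + 2) ^ (4 * card A * b)"
        using card by (intro power_increasing mult_le_mono1) auto
      finally show ?thesis .
    qed
    have eq: "eval (Add (Reg 2) (Add (Reg 0) (Add (Reg 0) (Reg 0)))) s2 = n * n + 3 * n"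
      using regs by simp
    show ?case
      unfolding eq
    proof (rule wp_mono[OF wp_search[OF env S(1), of b]], goal_cases)
      case 1 then show ?case using regs by simp
    next
      case 2 then show ?case using regs by simp
    next
      case 3 then show ?case using regs by simp
    next
      case 4 then show ?case using ex S by simp
    next
      case (5 d c) then show ?case using least S by simp
    next
      case (6 t3 s3)
      have "t3 \<le> search_bound n b ((8 * card A + 2) ^ (4 * card A * b))"
        using 6 search_bound_mono[OF K] le_trans by blast
      moreover have "outputs_cand n D S b c ((fst s3)(0 := b), snd s3) \<longleftrightarrow> outputs_cand n D S b c s3" for c
        by (simp add: outputs_cand_def)
      ultimately show ?case
        using 6 7 2 s S(1,2) by (auto simp: box_prog_bound_def env_def)
    qed
  qed (use 2 s A in auto)
qed

section \<open>Normal form of interval supergraphs\<close>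

lemma digits_exist:
  fixes M :: nat
  assumes "\<And>p. g p < M"
  shows "\<exists>c < M ^ L. \<forall>p < L. c div M ^ p mod M = g p"
  using assms
proof (induction L arbitrary: g)
  case 0
  then show ?case by simp
next
  case (Suc L)
  have M: "M > 0" using Suc.prems[of 0] by simp
  obtain c where c: "c < M ^ L" "\<And>p. p < L \<Longrightarrow> c div M ^ p mod M = g (Suc p)"
    using Suc.IH[of "\<lambda>p. g (Suc p)"] Suc.prems by auto
  define c' where "c' = g 0 + M * c"
  have "c' div M = c" "c' mod M = g 0" using Suc.prems[of 0] M by (auto simp: c'_def)
  moreover have "c' < M ^ Suc L"
  proof -
    have "c' < M * Suc c" using Suc.prems[of 0] by (simp add: c'_def)
    also have "\<dots> \<le> M * M ^ L" using c(1) by (intro mult_le_mono2) simp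
    finally show ?thesis by simp
  qed
  moreover have "c' div M ^ p mod M = g p" if "p < Suc L" for p
    using that c(2) \<open>c' div M = c\<close> \<open>c' mod M = g 0\<close>
    by (cases p) (auto simp: div_mult2_eq)
  ultimately show ?case by blast
qed

lemma cnt_less:
  assumes "finite S" "i \<in> S" "i < j"
  shows "cnt S i < cnt S j"
  unfolding cnt_def using assms by (intro psubset_card_mono) auto

lemma cnt_less_card:
  assumes "finite S" "i \<in> S"
  shows "cnt S i < card S"
  unfolding cnt_def using assms by (intro psubset_card_mono) auto

lemma inj_on_cnt: "finite S \<Longrightarrow> inj_on (cnt S) S"
  by (rule linorder_inj_onI') (metis cnt_less less_irrefl)

text \<open>Surjectivity of decoding: all data below the base come from some number in the search
  range.\<close>

lemma candidate_exists:
  assumes S: "finite S"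
    and lw: "\<And>t i. t < d \<Longrightarrow> i \<in> S \<Longrightarrow> l t i < base S \<and> w t i < base S"
  shows "\<exists>c < base S ^ (2 * card S * d). \<forall>t < d. \<forall>i \<in> S.
    dec_left S (c div base S ^ (2 * card S * t)) i = l t i \<and>
    dec_right S (c div base S ^ (2 * card S * t)) i = l t i + w t i"
proof -
  define m where "m = card S"
  \<comment> \<open>Position \<open>p\<close> belongs to graph \<open>p div (2 * m)\<close> and to
    the vertex of rank \<open>p mod (2 * m) div 2\<close>; its parity selects endpoint or length.
    Reducing modulo the base makes \<open>g\<close> a digit also at positions that \<open>lw\<close>
    does not control.\<close>
  define g where "g = (\<lambda>p. (let i = inv_into S (cnt S) (p mod (2 * m) div 2)
     in if even p then l (p div (2 * m)) i else w (p div (2 * m)) i) mod base S)"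
  have "base S > 0" by (simp add: base_def)
  then have "g p < base S" for p by (simp add: g_def)
  from digits_exist[where g = g, OF this, of "2 * m * d"] obtain c
    where c: "c < base S ^ (2 * m * d)" "\<And>p. p < 2 * m * d \<Longrightarrow> c div base S ^ p mod base S = g p"
    by blast
  have g: "c div base S ^ (2 * m * t + (2 * cnt S i + e)) mod base S = (if e = 0 then l t i else w t i)"
    if "t < d" "i \<in> S" "e < 2" for t i e
  proof -
    have lt: "2 * cnt S i + e < 2 * m" using cnt_less_card[OF S that(2)] that(3) by (simp add: m_def)
    have "m * t + m \<le> m * d" using that(1) by (metis Suc_leI mult_Suc_right mult_le_mono2 add.commute)
    define q where "q = 2 * m * t + (2 * cnt S i + e)"
    have "q < 2 * m * d" using lt \<open>m * t + m \<le> m * d\<close> unfolding q_def by linarith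
    then have cq: "c div base S ^ q mod base S = g q" by (rule c(2))
    have div: "q div (2 * m) = t" using lt by (simp add: q_def)
    have mod: "q mod (2 * m) = 2 * cnt S i + e" using lt by (simp add: q_def)
    have half: "(2 * cnt S i + e) div 2 = cnt S i" using that(3) by simp
    have inv: "inv_into S (cnt S) (cnt S i) = i" using inj_on_cnt[OF S] that(2) by (rule inv_into_f_f)
    have even: "even q \<longleftrightarrow> e = 0" using that(3) by (auto simp: q_def less_2_cases_iff)
    have "g q = (if e = 0 then l t i else w t i) mod base S"
      unfolding g_def Let_def div mod half inv even ..
    then show ?thesis using lw[OF that(1,2)] cq unfolding q_def[symmetric] by (simp split: if_splits)
  qed
  have "dec_left S (c div base S ^ (2 * m * t)) i = l t i"
    "dec_right S (c div base S ^ (2 * m * t)) i = l t i + w t i" if "t < d" "i \<in> S" for t i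
    using g[OF that, of 0] g[OF that, of 1]
    unfolding dec_left_def dec_right_def power_add div_mult2_eq by simp_all
  then show ?thesis using c(1) by (auto simp: m_def)
qed

text \<open>Counting the smaller elements is strictly monotone on \<open>T\<close>, so real
  endpoints can be replaced by natural numbers without changing their order.\<close>

lemma rank_le_iff:
  fixes T :: "real set"
  assumes "finite T" "x \<in> T" "y \<in> T"
  shows "card {z \<in> T. z < x} \<le> card {z \<in> T. z < y} \<longleftrightarrow> x \<le> y"
proof
  assume "x \<le> y"
  then show "card {z \<in> T. z < x} \<le> card {z \<in> T. z < y}"
    using assms by (intro card_mono) auto
next
  assume le: "card {z \<in> T. z < x} \<le> card {z \<in> T. z < y}"
  show "x \<le> y"
  proof (rule ccontr)
    assume "\<not> x \<le> y"
    then have "y < x" by simp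
    then have "{z \<in> T. z < y} \<subseteq> {z \<in> T. z < x}" "y \<in> {z \<in> T. z < x}" "y \<notin> {z \<in> T. z < y}"
      using assms(3) by auto
    then have "{z \<in> T. z < y} \<subset> {z \<in> T. z < x}" by blast
    then have "card {z \<in> T. z < y} < card {z \<in> T. z < x}"
      using assms(1) by (intro psubset_card_mono) simp_all
    then show False using le by simp
  qed
qed

text \<open>Shrinking may lose edges of the interval supergraph \<open>adj'\<close>, but none of the
  input graph \<open>adj\<close>. Lying between the two is enough, since the supergraphs intersect
  in the input graph.\<close>

definition sandwiched ::
  "nat \<Rightarrow> nat set \<Rightarrow> (nat \<Rightarrow> nat set) \<Rightarrow> (nat \<Rightarrow> nat \<Rightarrow> bool) \<Rightarrow> (nat \<Rightarrow> nat \<Rightarrow> bool) \<Rightarrow>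
    (nat \<Rightarrow> nat) \<Rightarrow> (nat \<Rightarrow> nat) \<Rightarrow> bool" where
  "sandwiched n S N adj adj' l r \<longleftrightarrow>
    (\<forall>i < n. \<forall>j < n. i \<noteq> j \<longrightarrow>
      (adj i j \<longrightarrow> meets (ext_left S N (2 * card S + 1) l r) (ext_right S N (2 * card S + 1) l r) i j) \<and>
      (meets (ext_left S N (2 * card S + 1) l r) (ext_right S N (2 * card S + 1) l r) i j \<longrightarrow> adj' i j))"

text \<open>The ranks of the endpoints of \<open>S\<close> and of the common point carry all the
  information. The conclusion ranges over all \<open>L\<close> and \<open>R\<close> that agree with
  the ranks on \<open>S\<close>, because decoding yields arbitrary values elsewhere.\<close>

lemma interval_supergraph_compress:
  fixes l r :: "nat \<Rightarrow> real"
  assumes S: "S \<subseteq> {..<n}"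
    and lr: "\<And>i. i < n \<Longrightarrow> l i \<le> r i"
    and sym: "\<And>i j. adj i j \<Longrightarrow> adj j i"
    and super: "\<And>i j. i < n \<Longrightarrow> j < n \<Longrightarrow> i \<noteq> j \<Longrightarrow> adj i j \<Longrightarrow> l i \<le> r j"
    and clique: "\<And>i j. i < n \<Longrightarrow> j < n \<Longrightarrow> i \<noteq> j \<Longrightarrow> i \<notin> S \<Longrightarrow> j \<notin> S \<Longrightarrow> adj i j"
    and N: "\<And>i. i < n \<Longrightarrow> N i = {j \<in> S. adj i j}"
    and adj': "\<And>i j. i < n \<Longrightarrow> j < n \<Longrightarrow> i \<noteq> j \<Longrightarrow> l i \<le> r j \<Longrightarrow> l j \<le> r i \<Longrightarrow> adj' i j"
  shows "\<exists>l' w'. (\<forall>i \<in> S. l' i < base S \<and> w' i < base S) \<and>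
    (\<forall>L R. (\<forall>i \<in> S. L i = l' i \<and> R i = l' i + w' i) \<longrightarrow> sandwiched n S N adj adj' L R)"
proof -
  define m where "m = card S"
  have fS: "finite S" using S finite_subset by blast
  have lr': "l i \<le> r j" if "i < n" "j < n" "i \<notin> S" "j \<notin> S" for i j
    using that lr super clique by (cases "i = j") auto
  \<comment> \<open>Helly's theorem on the line: any two intervals outside \<open>S\<close> meet, so
    the largest left endpoint lies in all of them.\<close>
  obtain p where p: "l i \<le> p \<and> p \<le> r i" if "i < n" "i \<notin> S" for i
  proof (cases "{..<n} - S = {}")
    case True
    then show ?thesis using that by auto
  next
    case False
    show ?thesis
    proof (rule that[of "Max (l ` ({..<n} - S))"])
      fix i assume "i < n" "i \<notin> S"
      then have "l i \<le> Max (l ` ({..<n} - S))" by (intro Max_ge) auto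
      moreover have "Max (l ` ({..<n} - S)) \<le> r i"
        using False lr' \<open>i < n\<close> \<open>i \<notin> S\<close> by (intro Max.boundedI) auto
      ultimately show "l i \<le> Max (l ` ({..<n} - S)) \<and> Max (l ` ({..<n} - S)) \<le> r i" ..
    qed
  qed
  define T where "T = insert p (l ` S \<union> r ` S)"
  define rk where "rk = (\<lambda>x. card {z \<in> T. z < x})"
  \<comment> \<open>\<open>T\<close> has at most \<open>2 * m + 1\<close> points, so ranks are at
    most \<open>2 * m\<close>. The shift puts \<open>p\<close> at \<open>2 * m + 1\<close> and keeps
    all values on \<open>T\<close> below the base \<open>4 * m + 2\<close>.\<close>
  define \<phi> where "\<phi> = (\<lambda>x. rk x + (2 * m + 1 - rk p))"
  have fT: "finite T" using fS by (simp add: T_def)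
  have "card T \<le> Suc (card (l ` S \<union> r ` S))"
    unfolding T_def by (rule card_insert_le_m1[THEN le_trans]) (use fS in auto)
  also have "card (l ` S \<union> r ` S) \<le> card (l ` S) + card (r ` S)" by (rule card_Un_le)
  also have "\<dots> \<le> m + m" unfolding m_def using fS by (intro add_mono card_image_le)
  finally have cT: "card T \<le> 2 * m + 1" by simp
  have rk: "rk x \<le> 2 * m" if "x \<in> T" for x
  proof -
    have "rk x < card T" unfolding rk_def using fT that by (intro psubset_card_mono) auto
    then show ?thesis using cT by simp
  qed
  have Tmem: "p \<in> T" "\<And>i. i \<in> S \<Longrightarrow> l i \<in> T" "\<And>i. i \<in> S \<Longrightarrow> r i \<in> T" by (auto simp: T_def)
  have \<phi>p: "\<phi> p = 2 * m + 1" using rk[OF Tmem(1)] by (simp add: \<phi>_def)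
  have \<phi>_le: "\<phi> x \<le> \<phi> y \<longleftrightarrow> x \<le> y" if "x \<in> T" "y \<in> T" for x y
    using rank_le_iff[OF fT that] by (simp add: \<phi>_def rk_def)
  have \<phi>_less: "\<phi> x < base S" if "x \<in> T" for x
    using rk[OF that] by (simp add: \<phi>_def base_def m_def)
  define l' where "l' = (\<lambda>i. \<phi> (l i))"
  define w' where "w' = (\<lambda>i. \<phi> (r i) - \<phi> (l i))"
  show ?thesis
  unfolding sandwiched_def
  proof (rule exI[of _ l'], rule exI[of _ w'], intro conjI ballI allI impI)
    fix i assume "i \<in> S"
    then show "l' i < base S" "w' i < base S"
      using \<phi>_less Tmem by (auto simp: l'_def w'_def intro: le_less_trans[OF diff_le_self])
  next
    fix L R :: "nat \<Rightarrow> nat" and i j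
    assume LR: "\<forall>i \<in> S. L i = l' i \<and> R i = l' i + w' i" and ij: "i < n" "j < n" "i \<noteq> j"
    let ?L = "ext_left S N (2 * card S + 1) L R" and ?R = "ext_right S N (2 * card S + 1) L R"
    have LRS: "L i = \<phi> (l i)" "R i = \<phi> (r i)" if "i \<in> S" for i
    proof -
      have "\<phi> (l i) \<le> \<phi> (r i)" using \<phi>_le Tmem that lr S by auto
      then show "L i = \<phi> (l i)" "R i = \<phi> (r i)" using LR that by (auto simp: l'_def w'_def)
    qed
    have fN: "finite (N i)" "N i \<subseteq> S" if "i < n" for i
      using N[OF that] fS by auto
    have L1: "?L i \<le> \<phi> p" if "i < n" "i \<notin> S" for i
      using fN[OF that(1)] that by (simp add: ext_left_def \<phi>p m_def)
    have L2: "?L i \<le> \<phi> (r j)" if "i < n" "i \<notin> S" "j \<in> N i" for i j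
    proof -
      have "Min (insert (2 * card S + 1) (R ` N i)) \<le> R j"
        using fN[OF that(1)] that by (intro Min_le) auto
      moreover have "j \<in> S" using fN(2)[OF that(1)] that(3) by auto
      ultimately show ?thesis using that(2) LRS[of j] by (simp only: ext_left_def if_False simp_thms)
    qed
    have R1: "\<phi> p \<le> ?R i" if "i < n" "i \<notin> S" for i
      using fN[OF that(1)] that by (simp add: ext_right_def \<phi>p m_def)
    have R2: "\<phi> (l j) \<le> ?R i" if "i < n" "i \<notin> S" "j \<in> N i" for i j
    proof -
      have "L j \<le> Max (insert (2 * card S + 1) (L ` N i))"
        using fN[OF that(1)] that by (intro Max_ge) auto
      moreover have "j \<in> S" using fN(2)[OF that(1)] that(3) by auto
      ultimately show ?thesis using that(2) LRS[of j] by (simp only: ext_right_def if_False simp_thms)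
    qed
    \<comment> \<open>\<open>L3\<close> and \<open>R3\<close> say that, read back through
      \<open>\<phi>\<close>, every interval only shrinks: the minimum is attained at the image of
      \<open>p\<close> or of some \<open>r k\<close>, and neither lies to the left of
      \<open>l i\<close>.\<close>
    have L3: "l i \<le> x" if "i < n" "x \<in> T" "?L i \<le> \<phi> x" for i x
    proof (cases "i \<in> S")
      case True
      then show ?thesis using that \<phi>_le Tmem by (simp add: ext_left_def LRS)
    next
      case False
      have "?L i \<in> insert (\<phi> p) (R ` N i)"
        using False Min_in[of "insert (2 * card S + 1) (R ` N i)"] fN[OF that(1)]
        by (simp add: ext_left_def \<phi>p m_def)
      then consider "?L i = \<phi> p" | k where "k \<in> N i" "?L i = R k" by auto
      then show ?thesis
      proof cases
        case 1
        then have "p \<le> x" using that \<phi>_le[OF Tmem(1) that(2)] by simp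
        then show ?thesis using p[OF that(1) False] by linarith
      next
        case 2
        then have k: "k \<in> S" "adj i k" using N[OF that(1)] by auto
        then have "r k \<le> x" using 2 that \<phi>_le[OF Tmem(3) that(2)] LRS by simp
        moreover have "l i \<le> r k" using super[OF that(1) _ _ k(2)] k(1) S False by blast
        ultimately show ?thesis by simp
      qed
    qed
    have R3: "x \<le> r i" if "i < n" "x \<in> T" "\<phi> x \<le> ?R i" for i x
    proof (cases "i \<in> S")
      case True
      then show ?thesis using that \<phi>_le Tmem by (simp add: ext_right_def LRS)
    next
      case False
      have "?R i \<in> insert (\<phi> p) (L ` N i)"
        using False Max_in[of "insert (2 * card S + 1) (L ` N i)"] fN[OF that(1)]
        by (simp add: ext_right_def \<phi>p m_def)
      then consider "?R i = \<phi> p" | k where "k \<in> N i" "?R i = L k" by auto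
      then show ?thesis
      proof cases
        case 1
        then have "x \<le> p" using that \<phi>_le[OF that(2) Tmem(1)] by simp
        then show ?thesis using p[OF that(1) False] by linarith
      next
        case 2
        then have k: "k \<in> S" "adj k i" using N[OF that(1)] sym[of i k] by auto
        then have "x \<le> l k" using 2 that \<phi>_le[OF that(2) Tmem(2)] LRS by simp
        moreover have "l k \<le> r i" using super[OF _ that(1) _ k(2)] k(1) S False by blast
        ultimately show ?thesis by simp
      qed
    qed
    have sound: "l i \<le> r j" if "i < n" "j < n" "?L i \<le> ?R j" for i j
    proof (cases "i \<in> S")
      case True
      then show ?thesis using that R3[of j "l i"] Tmem by (simp add: ext_left_def LRS)
    next
      case iS: False
      show ?thesis
      proof (cases "j \<in> S")
        case True
        then show ?thesis using that L3[of i "r j"] Tmem by (simp add: ext_right_def LRS)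
      next
        case False
        then show ?thesis using lr' that iS by blast
      qed
    qed
    \<comment> \<open>The extension reaches every neighbour in \<open>S\<close> by construction, and
      two vertices outside \<open>S\<close> share the image of \<open>p\<close>.\<close>
    have complete: "?L i \<le> ?R j" if "i < n" "j < n" "i \<noteq> j" "adj i j" for i j
    proof (cases "i \<in> S")
      case iS: True
      show ?thesis
      proof (cases "j \<in> S")
        case True
        then show ?thesis using iS that super \<phi>_le Tmem by (simp add: ext_left_def ext_right_def LRS)
      next
        case False
        then show ?thesis
          using iS that R2[of j i] sym[OF that(4)] N[OF that(2)] by (simp add: ext_left_def LRS)
      qed
    next
      case iS: False
      show ?thesis
      proof (cases "j \<in> S")
        case True
        then show ?thesis
          using iS that L2[of i j] N[OF that(1)] by (simp add: ext_right_def LRS)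
      next
        case False
        then show ?thesis using iS that L1[of i] R1[of j] by simp
      qed
    qed
    show "meets ?L ?R i j" if "adj i j"
      using complete[OF ij that] complete[OF ij(2,1) _ sym[OF that]] ij by (simp add: meets_def)
    show "adj' i j" if "meets ?L ?R i j"
      using sound[of i j] sound[of j i] ij that by (intro adj') (simp_all add: meets_def)
  qed
qed

section \<open>Boxicity\<close>

lemma pair_in_all_edges: "{u, v} \<in> all_edges V \<longleftrightarrow> u \<in> V \<and> v \<in> V \<and> u \<noteq> v"
  by (auto simp: all_edges_def doubleton_eq_iff)

lemma interval_graphI:
  fixes l r :: "'a \<Rightarrow> real"
  assumes "finite V" "I \<subseteq> all_edges V" "\<And>v. v \<in> V \<Longrightarrow> l v \<le> r v"
    and "\<And>u v. u \<in> V \<Longrightarrow> v \<in> V \<Longrightarrow> u \<noteq> v \<Longrightarrow> {u, v} \<in> I \<longleftrightarrow> l u \<le> r v \<and> l v \<le> r u"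
  shows "interval_graph V I"
  unfolding interval_graph_def simple_graph_def
  using assms by (intro conjI exI[of _ l] exI[of _ r]) auto

lemma interval_graphE:
  assumes "interval_graph V I"
  obtains l r :: "'a \<Rightarrow> real" where "\<And>v. v \<in> V \<Longrightarrow> l v \<le> r v"
    "\<And>u v. u \<in> V \<Longrightarrow> v \<in> V \<Longrightarrow> u \<noteq> v \<Longrightarrow> {u, v} \<in> I \<longleftrightarrow> l u \<le> r v \<and> l v \<le> r u"
proof -
  obtain l r :: "'a \<Rightarrow> real" where lr: "\<And>v. v \<in> V \<Longrightarrow> l v \<le> r v"
    "\<And>u v. u \<in> V \<Longrightarrow> v \<in> V \<Longrightarrow> u \<noteq> v \<Longrightarrow> {u, v} \<in> I \<longleftrightarrow> {l u..r u} \<inter> {l v..r v} \<noteq> {}"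
    using assms unfolding interval_graph_def by blast
  have "{u, v} \<in> I \<longleftrightarrow> l u \<le> r v \<and> l v \<le> r u" if "u \<in> V" "v \<in> V" "u \<noteq> v" for u v
    using lr(2)[OF that] lr(1)[OF that(1)] lr(1)[OF that(2)] by auto
  with lr(1) show ?thesis by (rule that)
qed

text \<open>Every non-edge has an endpoint \<open>a\<close> in \<open>A\<close>, since the rest is a
  clique, and is removed by the graph of that \<open>a\<close>.\<close>

lemma box_representation_of_cover:
  assumes G: "simple_graph V E" and A: "A \<subseteq> V"
    and clique: "complete_graph (V - A) (induced_edges E (V - A))"
  shows "\<exists>Is. length Is = card A \<and> box_representation V E Is"
proof -
  have fin: "finite V" "finite A" and E: "E \<subseteq> all_edges V"
    using G A by (auto simp: simple_graph_def intro: finite_subset)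
  obtain as where as: "set as = A" "distinct as" using finite_distinct_list[OF fin(2)] by blast
  define I where "I = (\<lambda>a. all_edges V - {{a, v} | v. {a, v} \<notin> E})"
  have "interval_graph V (I a)" if "a \<in> A" for a
  \<comment> \<open>\<open>a\<close> gets the point 0, its neighbours get \<open>[0, 1]\<close> and
    the other vertices the point 1, so only pairs of \<open>a\<close> with a non-neighbour are
    disjoint.\<close>
  proof (rule interval_graphI[where l = "\<lambda>u. if u = a \<or> {a, u} \<in> E then 0 else 1" and
        r = "\<lambda>u. if u = a then 0 else 1"])
    fix u v assume uv: "u \<in> V" "v \<in> V" "u \<noteq> v"
    then have "{u, v} \<in> I a \<longleftrightarrow> (u = a \<longrightarrow> {a, v} \<in> E) \<and> (v = a \<longrightarrow> {a, u} \<in> E)"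
      by (auto simp: I_def pair_in_all_edges doubleton_eq_iff insert_commute)
    then show "{u, v} \<in> I a \<longleftrightarrow>
        (if u = a \<or> {a, u} \<in> E then 0 else 1) \<le> (if v = a then 0 else 1 :: real) \<and>
        (if v = a \<or> {a, v} \<in> E then 0 else 1) \<le> (if u = a then 0 else 1 :: real)"
      using uv by auto
  qed (use fin in \<open>auto simp: I_def\<close>)
  moreover have "E = all_edges V \<inter> \<Inter> (I ` A)"
  proof
    show "E \<subseteq> all_edges V \<inter> \<Inter> (I ` A)" using E by (auto simp: I_def)
    show "all_edges V \<inter> \<Inter> (I ` A) \<subseteq> E"
    proof
      fix e assume e: "e \<in> all_edges V \<inter> \<Inter> (I ` A)"
      then obtain u v where uv: "e = {u, v}" "u \<in> V" "v \<in> V" "u \<noteq> v" by (auto simp: all_edges_def)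
      have "{u, v} \<in> E" if "u \<in> A"
      proof -
        have "{u, v} \<in> I u" using e uv(1) that by blast
        then show ?thesis by (auto simp: I_def)
      qed
      moreover have "{u, v} \<in> E" if "v \<in> A"
      proof -
        have "{v, u} \<in> I v" using e uv(1) that by (simp add: insert_commute)
        then have "{v, u} \<in> E" by (auto simp: I_def)
        then show ?thesis by (simp add: insert_commute)
      qed
      moreover have "{u, v} \<in> E" if "u \<notin> A" "v \<notin> A"
      proof -
        have "{u, v} \<in> all_edges (V - A)" using uv that by (simp add: pair_in_all_edges)
        then show ?thesis using clique by (auto simp: complete_graph_def induced_edges_def)
      qed
      ultimately show "e \<in> E" using uv by blast
    qed
  qed
  ultimately have "box_representation V E (map I as)"
    using as by (simp add: box_representation_def)
  moreover have "length (map I as) = card A" using as distinct_card by fastforce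
  ultimately show ?thesis by blast
qed

text \<open>The empty list represents exactly the complete graphs, so the value 0 given to them is
  the least length as well.\<close>

lemma boxicity_eq_Least:
  "boxicity V E = (LEAST k. \<exists>Is. length Is = k \<and> box_representation V E Is)"
proof (cases "complete_graph V E")
  case True
  then have "box_representation V E []"
    by (simp add: box_representation_def complete_graph_def)
  then have "(LEAST k. \<exists>Is. length Is = k \<and> box_representation V E Is) = 0"
    by (intro Least_eq_0) auto
  then show ?thesis using True by (simp add: boxicity_def)
qed (simp add: boxicity_def)

lemma boxicity_le: "box_representation V E Is \<Longrightarrow> boxicity V E \<le> length Is"
  unfolding boxicity_eq_Least by (rule Least_le) blast

lemma boxicity_attained:
  assumes "box_representation V E Is"
  obtains Js where "length Js = boxicity V E" "box_representation V E Js"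
proof -
  have "\<exists>Js. length Js = boxicity V E \<and> box_representation V E Js"
    unfolding boxicity_eq_Least by (rule LeastI_ex) (use assms in blast)
  then show ?thesis using that by blast
qed

section \<open>From positions in the enumeration to vertices\<close>

definition meet_edges :: "'a list \<Rightarrow> (nat \<Rightarrow> nat) \<Rightarrow> (nat \<Rightarrow> nat) \<Rightarrow> 'a set set" where
  "meet_edges vs l r = {{vs ! i, vs ! j} | i j. i < length vs \<and> j < length vs \<and> meets l r i j}"

lemma meet_edges_iff:
  assumes "distinct vs" "i < length vs" "j < length vs"
  shows "{vs ! i, vs ! j} \<in> meet_edges vs l r \<longleftrightarrow> meets l r i j"
  using assms by (auto simp: meet_edges_def doubleton_eq_iff nth_eq_iff_index_eq meets_def)

lemma interval_graph_meet_edges: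
  assumes vs: "distinct vs" "set vs = V" and lr: "\<And>i. i < length vs \<Longrightarrow> l i \<le> r i"
  shows "interval_graph V (meet_edges vs l r)"
proof -
  define idx where "idx = inv_into {..<length vs} ((!) vs)"
  have idx: "idx (vs ! i) = i" if "i < length vs" for i
    unfolding idx_def using that vs by (intro inv_into_f_f inj_on_nth) auto
  show ?thesis
  proof (rule interval_graphI[where l = "\<lambda>v. real (l (idx v))" and r = "\<lambda>v. real (r (idx v))"])
    show "finite V" using vs by auto
    show "meet_edges vs l r \<subseteq> all_edges V"
      using vs by (auto simp: meet_edges_def pair_in_all_edges meets_def nth_eq_iff_index_eq)
    show "real (l (idx v)) \<le> real (r (idx v))" if "v \<in> V" for v
      using that lr idx vs by (auto simp: in_set_conv_nth)
    show "{u, v} \<in> meet_edges vs l r \<longleftrightarrow>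
        real (l (idx u)) \<le> real (r (idx v)) \<and> real (l (idx v)) \<le> real (r (idx u))"
      if uv: "u \<in> V" "v \<in> V" "u \<noteq> v" for u v
    proof -
      obtain i j where "u = vs ! i" "i < length vs" "v = vs ! j" "j < length vs"
        using uv vs by (metis in_set_conv_nth)
      then show ?thesis using uv vs(1) by (auto simp: meet_edges_iff idx meets_def)
    qed
  qed
qed

lemma box_representation_meet_edges:
  assumes vs: "distinct vs" "set vs = V" and G: "simple_graph V E"
    and lr: "\<And>t i. t < d \<Longrightarrow> i < length vs \<Longrightarrow> l t i \<le> r t i"
    and E: "\<And>i j. i < length vs \<Longrightarrow> j < length vs \<Longrightarrow> i \<noteq> j \<Longrightarrow>
      {vs ! i, vs ! j} \<in> E \<longleftrightarrow> (\<forall>t < d. meets (l t) (r t) i j)"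
  shows "box_representation V E (map (\<lambda>t. meet_edges vs (l t) (r t)) [0..<d])"
proof -
  have iff: "e \<in> E \<longleftrightarrow> (\<forall>t < d. e \<in> meet_edges vs (l t) (r t))" if "e \<in> all_edges V" for e
  proof -
    obtain u v where uv: "e = {u, v}" "u \<in> V" "v \<in> V" "u \<noteq> v"
      using \<open>e \<in> all_edges V\<close> by (auto simp: all_edges_def)
    obtain i j where "u = vs ! i" "i < length vs" "v = vs ! j" "j < length vs"
      using uv vs by (metis in_set_conv_nth)
    then show ?thesis using E uv vs by (auto simp: meet_edges_iff)
  qed
  have "E \<subseteq> all_edges V" using G by (simp add: simple_graph_def)
  with iff have "E = all_edges V \<inter> (\<Inter>t\<in>{0..<d}. meet_edges vs (l t) (r t))" by auto
  moreover have "interval_graph V (meet_edges vs (l t) (r t))" if "t < d" for t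
    using vs lr[OF that] by (rule interval_graph_meet_edges)
  ultimately show ?thesis by (auto simp: box_representation_def)
qed

text \<open>The set \<open>D\<close> of the program. Positions from
  \<open>length vs * length vs\<close> on carry no meaning, because \<open>vs !\<close> is
  unspecified out of range; \<open>good_cand\<close>, \<open>covers\<close> and the input state
  inspect only smaller ones.\<close>

definition edge_positions :: "'a list \<Rightarrow> 'a set set \<Rightarrow> nat set" where
  "edge_positions vs E = {p. {vs ! (p div length vs), vs ! (p mod length vs)} \<in> E}"

lemma edge_positions_iff:
  assumes "j < length vs"
  shows "i * length vs + j \<in> edge_positions vs E \<longleftrightarrow> {vs ! i, vs ! j} \<in> E"
proof -
  have "(i * length vs + j) div length vs = i" using assms by (subst div_mult_self3) auto
  then show ?thesis using assms by (simp add: edge_positions_def)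
qed

lemma index_pair_less: "i < n \<Longrightarrow> j < n \<Longrightarrow> i * n + j < n * (n :: nat)"
  by (metis add_less_cancel_left less_le_trans mult_Suc add.commute Suc_leI mult_le_mono1)

lemma all_positions_iff:
  "(\<forall>p < n * n. Q (p div n) (p mod n)) \<longleftrightarrow> (\<forall>i < n. \<forall>j < n. Q i (j :: nat))"
proof (intro iffI allI impI)
  fix i j assume "\<forall>p < n * n. Q (p div n) (p mod n)" "i < n" "j < n"
  then show "Q i j" using index_pair_less[of i n j] by (metis div_mult_self3 div_less add_cancel_right_right
    mod_mult_self3 mod_less add.commute gr_implies_not0)
next
  fix p assume a: "\<forall>i < n. \<forall>j < n. Q i j" "p < n * n"
  then have "n > 0" by (cases n) auto
  then show "Q (p div n) (p mod n)" using a by (simp add: less_mult_imp_div_less)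
qed

lemma good_cand_iff:
  "good_cand (length vs) (edge_positions vs E) S d c \<longleftrightarrow>
    (\<forall>i < length vs. \<forall>j < length vs. i \<noteq> j \<longrightarrow> ({vs ! i, vs ! j} \<in> E \<longleftrightarrow>
      (\<forall>t < d. meets (cand_left (length vs) (edge_positions vs E) S c t)
        (cand_right (length vs) (edge_positions vs E) S c t) i j)))"
  unfolding all_positions_iff[symmetric] by (simp add: good_cand_def edge_positions_def)

lemma covers_iff:
  "covers (length vs) (edge_positions vs E) (length vs * length vs) S \<longleftrightarrow>
    (\<forall>i < length vs. \<forall>j < length vs. i \<noteq> j \<longrightarrow> {vs ! i, vs ! j} \<notin> E \<longrightarrow> i \<in> S \<or> j \<in> S)"
  unfolding all_positions_iff[symmetric] by (simp add: covers_def edge_positions_def)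

lemma cand_left_le_right:
  assumes "S \<subseteq> {..<n}"
  shows "cand_left n D S c t i \<le> cand_right n D S c t i"
proof (cases "i \<in> S")
  case True
  then show ?thesis by (simp add: cand_left_def cand_right_def ext_left_def ext_right_def dec_right_def)
next
  case False
  have "Min (insert P (r ` N)) \<le> Max (insert P (l ` N))" if "finite N" for P :: nat and l r and N :: "nat set"
    using that by (intro order.trans[OF Min_le Max_ge, of _ P]) auto
  with finite_nbrs[OF assms] show ?thesis
    using False by (simp only: cand_left_def cand_right_def ext_left_def ext_right_def if_False)
qed

text \<open>Soundness of the check: decoded intervals are never empty, and \<open>good_cand\<close>
  compares the intersection with \<open>E\<close> outright. Consequently no candidate of a dimension
  below the boxicity passes.\<close>

lemma good_cand_imp_box_representation:
  assumes vs: "distinct vs" "set vs = V" and G: "simple_graph V E" and S: "S \<subseteq> {..<length vs}"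
    and good: "good_cand (length vs) (edge_positions vs E) S d c"
  shows "box_representation V E (map (\<lambda>t. meet_edges vs
     (cand_left (length vs) (edge_positions vs E) S c t)
     (cand_right (length vs) (edge_positions vs E) S c t)) [0..<d])"
  using vs G cand_left_le_right[OF S] good[unfolded good_cand_iff]
  by (intro box_representation_meet_edges) auto

text \<open>Completeness of the search space: each interval graph of the representation is
  compressed separately. The resulting graphs contain \<open>E\<close> and are contained in the
  given ones, so their intersection is \<open>E\<close> again.\<close>

lemma box_representation_imp_good_cand:
  assumes vs: "distinct vs" "set vs = V" and G: "simple_graph V E" and S: "S \<subseteq> {..<length vs}"
    and cov: "covers (length vs) (edge_positions vs E) (length vs * length vs) S"
    and rep: "box_representation V E Is"
  shows "\<exists>c < base S ^ (2 * card S * length Is).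
    good_cand (length vs) (edge_positions vs E) S (length Is) c"
proof -
  let ?n = "length vs" and ?D = "edge_positions vs E" and ?d = "length Is" and ?P = "2 * card S + 1"
  let ?N = "nbrs ?n ?D S (?n * ?n)"
  define adj where "adj = (\<lambda>i j. {vs ! i, vs ! j} \<in> E)"
  have E: "E \<subseteq> all_edges V" using G by (simp add: simple_graph_def)
  have fS: "finite S" using S finite_subset by blast
  have sub: "E \<subseteq> Is ! t" if "t < ?d" for t
    using rep that nth_mem[OF that] unfolding box_representation_def by blast
  have N: "?N i = {j \<in> S. adj i j}" if "i < ?n" for i
    using S that index_pair_less[OF that] by (auto simp: nbrs_def adj_def edge_positions_iff)
  define Q where "Q = (\<lambda>t l' w'. (\<forall>i \<in> S. l' i < base S \<and> w' i < base S) \<and>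
    (\<forall>L R. (\<forall>i \<in> S. L i = l' i \<and> R i = l' i + w' i) \<longrightarrow>
      sandwiched ?n S ?N adj (\<lambda>i j. {vs ! i, vs ! j} \<in> Is ! t) L R))"
  have "\<exists>l' w'. Q t l' w'" if t: "t < ?d" for t
  proof -
    have "interval_graph V (Is ! t)" using rep t by (simp add: box_representation_def)
    then obtain l r :: "'a \<Rightarrow> real" where lr: "\<And>v. v \<in> V \<Longrightarrow> l v \<le> r v"
      "\<And>u v. u \<in> V \<Longrightarrow> v \<in> V \<Longrightarrow> u \<noteq> v \<Longrightarrow> {u, v} \<in> Is ! t \<longleftrightarrow> l u \<le> r v \<and> l v \<le> r u"
      by (erule interval_graphE)
    have iff: "{vs ! i, vs ! j} \<in> Is ! t \<longleftrightarrow> l (vs ! i) \<le> r (vs ! j) \<and> l (vs ! j) \<le> r (vs ! i)"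
      if "i < ?n" "j < ?n" "i \<noteq> j" for i j
      using that vs lr(2) by (simp add: nth_eq_iff_index_eq flip: vs(2))
    show ?thesis
      unfolding Q_def
    proof (rule interval_supergraph_compress[OF S, of "\<lambda>i. l (vs ! i)" "\<lambda>i. r (vs ! i)" adj])
      show "l (vs ! i) \<le> r (vs ! i)" if "i < ?n" for i
        using lr(1) vs(2) that by auto
      show "adj j i" if "adj i j" for i j
        using that by (simp add: adj_def insert_commute)
      show "l (vs ! i) \<le> r (vs ! j)" if "i < ?n" "j < ?n" "i \<noteq> j" "adj i j" for i j
        using iff[OF that(1-3)] sub[OF t] that(4) by (auto simp: adj_def)
      show "adj i j" if "i < ?n" "j < ?n" "i \<noteq> j" "i \<notin> S" "j \<notin> S" for i j
        using cov that unfolding covers_iff adj_def by blast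
      show "{vs ! i, vs ! j} \<in> Is ! t"
        if "i < ?n" "j < ?n" "i \<noteq> j" "l (vs ! i) \<le> r (vs ! j)" "l (vs ! j) \<le> r (vs ! i)" for i j
        using iff[OF that(1-3)] that(4,5) by simp
    qed (rule N)
  qed
  then obtain lf wf where Q: "\<And>t. t < ?d \<Longrightarrow> Q t (lf t) (wf t)" by metis
  obtain c where c: "c < base S ^ (2 * card S * ?d)"
    and dec: "\<And>t i. t < ?d \<Longrightarrow> i \<in> S \<Longrightarrow>
      dec_left S (c div base S ^ (2 * card S * t)) i = lf t i \<and>
      dec_right S (c div base S ^ (2 * card S * t)) i = lf t i + wf t i"
    using candidate_exists[OF fS, of ?d lf wf] Q unfolding Q_def by blast
  have sw: "sandwiched ?n S ?N adj (\<lambda>i j. {vs ! i, vs ! j} \<in> Is ! t)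
      (dec_left S (c div base S ^ (2 * card S * t))) (dec_right S (c div base S ^ (2 * card S * t)))"
    if "t < ?d" for t
    using Q[OF that] dec[OF that] unfolding Q_def by simp
  have m: "(adj i j \<longrightarrow> meets (cand_left ?n ?D S c t) (cand_right ?n ?D S c t) i j) \<and>
      (meets (cand_left ?n ?D S c t) (cand_right ?n ?D S c t) i j \<longrightarrow> {vs ! i, vs ! j} \<in> Is ! t)"
    if "t < ?d" "i < ?n" "j < ?n" "i \<noteq> j" for t i j
    unfolding cand_left_def cand_right_def
    using sw[OF that(1), unfolded sandwiched_def] that(2-4) by simp
  have "good_cand ?n ?D S ?d c"
    unfolding good_cand_iff
  proof (intro allI impI iffI)
    fix i j t assume "i < ?n" "j < ?n" "i \<noteq> j" "{vs ! i, vs ! j} \<in> E" "t < ?d"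
    then show "meets (cand_left ?n ?D S c t) (cand_right ?n ?D S c t) i j"
      using m by (simp add: adj_def)
  next
    fix i j assume ij: "i < ?n" "j < ?n" "i \<noteq> j"
      and "\<forall>t < ?d. meets (cand_left ?n ?D S c t) (cand_right ?n ?D S c t) i j"
    then have "{vs ! i, vs ! j} \<in> Is ! t" if "t < ?d" for t using m that by blast
    \<comment> \<open>This settles the empty list, where membership in
      \<open>\<Inter> (set Is)\<close> says nothing.\<close>
    moreover have "{vs ! i, vs ! j} \<in> all_edges V"
      using ij vs by (auto simp: pair_in_all_edges nth_eq_iff_index_eq)
    ultimately show "{vs ! i, vs ! j} \<in> E"
      using rep by (auto simp: box_representation_def in_set_conv_nth)
  qed
  with c show ?thesis by blast
qed

section \<open>Estimates for the running time\<close>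

lemma box_prog_bound_le:
  assumes n: "n \<ge> 1"
  shows "box_prog_bound n b K \<le> 3000 * (n * n) * ((b + 1) ^ 2 * (K + 1) ^ 2)"
proof -
  define N where "N = n * n"
  have N: "1 \<le> N" "n \<le> N" using n by (auto simp: N_def)
  \<comment> \<open>Up to constants, \<open>B\<close> bounds the number of rounds and
    \<open>N * B\<close> the cost of one round; their product explains the squares in the
    claim.\<close>
  define B where "B = (b + 1) * (K + 1)"
  have B: "1 \<le> B" "b \<le> B" "b * K + b \<le> B" "K \<le> B" by (auto simp: B_def)
  have "n * (60 * K + 200) \<le> N * (60 * K + 200)" using N by (intro mult_le_mono1)
  then have "n * (60 * K + 200) + 280 * (N + 1) + 40 \<le> N * (60 * K + 800)"
    using N by (simp add: algebra_simps)
  then have "b * (n * (60 * K + 200) + 280 * (N + 1) + 40) \<le> b * (N * (60 * K + 800))"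
    by (rule mult_le_mono2)
  also have "\<dots> \<le> N * (800 * (b * K + b))" by (simp add: algebra_simps)
  also have "\<dots> \<le> N * (800 * B)" using B by (intro mult_le_mono2) auto
  finally have 1: "b * (n * (60 * K + 200) + 280 * (N + 1) + 40) \<le> N * (800 * B)" .
  have "(120 + 40 * b) * (N + 1) \<le> (160 * B) * (2 * N)"
    using N B by (intro mult_le_mono) auto
  moreover have NB: "1 \<le> N * B" using N B by (simp add: Suc_leI)
  ultimately have "step_bound n b K + 4 \<le> N * B * 1300"
    using 1 unfolding step_bound_def N_def[symmetric] by (simp add: algebra_simps)
  moreover have "b * (K + 2) + K + 2 \<le> 2 * B" by (simp add: B_def algebra_simps)
  ultimately have "search_bound n b K \<le> (2 * B) * (N * B * 1300) + 4"
    unfolding search_bound_def by (intro add_mono mult_le_mono) auto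
  moreover define M where "M = N * (B * B)"
  ultimately have "search_bound n b K \<le> 2600 * M + 4" by (simp add: algebra_simps)
  moreover have "N \<le> M" using N B by (simp add: M_def)
  ultimately have "box_prog_bound n b K \<le> 3000 * M"
    using N unfolding box_prog_bound_def N_def[symmetric] by simp
  then show ?thesis by (simp add: M_def N_def B_def power2_eq_square algebra_simps)
qed

text \<open>For \<open>k \<ge> 2\<close> each factor is at most a power of \<open>k\<close>, which
  is rewritten as a power of 2. For \<open>k \<le> 1\<close> the exponent vanishes and the constant
  does the work; \<open>k = 1\<close> needs \<open>4 * 10001 ^ 2\<close>.\<close>

lemma candidate_count_le:
  assumes "a \<le> k" "b \<le> k"
  shows "real ((b + 1) ^ 2 * ((8 * a + 2) ^ (4 * a * b) + 1) ^ 2)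
    \<le> 10 ^ 9 * 2 powr (42 * (real k ^ 2 * log 2 (real k)))"
proof -
  define K where "K = (8 * k + 2) ^ (4 * (k * k))"
  have "(8 * a + 2) ^ (4 * a * b) \<le> (8 * k + 2) ^ (4 * a * b)"
    using assms by (intro power_mono) auto
  also have "\<dots> \<le> K"
    unfolding K_def using assms by (intro power_increasing) (auto intro: mult_le_mono)
  finally have "(b + 1) ^ 2 * ((8 * a + 2) ^ (4 * a * b) + 1) ^ 2 \<le> (k + 1) ^ 2 * (K + 1) ^ 2"
    using assms by (intro mult_le_mono power_mono) auto
  then have le: "real ((b + 1) ^ 2 * ((8 * a + 2) ^ (4 * a * b) + 1) ^ 2) \<le> real ((k + 1) ^ 2 * (K + 1) ^ 2)"
    by (rule of_nat_mono)
  consider "k = 0" | "k = 1" | "k \<ge> 2" by linarith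
  then show ?thesis
  proof cases
    case 1
    then have "real ((k + 1) ^ 2 * (K + 1) ^ 2) \<le> 10 ^ 9" by (simp add: K_def)
    then show ?thesis using le 1 by simp
  next
    case 2
    then have "real ((k + 1) ^ 2 * (K + 1) ^ 2) \<le> 10 ^ 9" by (simp add: K_def)
    then show ?thesis using le 2 by simp
  next
    case 3
    have "8 * k + 2 \<le> k ^ 5"
    proof -
      have "8 * k + 2 \<le> 2 ^ 4 * k" using 3 by simp
      also have "\<dots> \<le> k ^ 4 * k" using 3 by (intro mult_le_mono1 power_mono) auto
      finally show ?thesis by (simp add: power_eq_if)
    qed
    then have "K \<le> (k ^ 5) ^ (4 * (k * k))" unfolding K_def by (intro power_mono) auto
    then have K: "K \<le> k ^ (20 * (k * k))" by (simp flip: power_mult add: mult.assoc)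
    have "1 \<le> k ^ (20 * (k * k))" using 3 by simp
    then have "K + 1 \<le> 2 * k ^ (20 * (k * k))" using K by linarith
    also have "\<dots> \<le> k * k ^ (20 * (k * k))" using 3 by (intro mult_le_mono1)
    finally have K1: "K + 1 \<le> k ^ Suc (20 * (k * k))" by simp
    have "k + 1 \<le> 2 * k" using 3 by simp
    also have "\<dots> \<le> k ^ 2" using 3 by (simp add: power2_eq_square)
    finally have "(k + 1) ^ 2 * (K + 1) ^ 2 \<le> (k ^ 2) ^ 2 * (k ^ Suc (20 * (k * k))) ^ 2"
      using K1 by (intro mult_le_mono power_mono) auto
    also have "\<dots> = k ^ (40 * (k * k) + 6)"
      by (simp flip: power_mult power_add power_Suc add: algebra_simps)
    also have "\<dots> \<le> k ^ (42 * (k * k))"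
    proof (rule power_increasing)
      have "2 * 2 \<le> k * k" using 3 by (intro mult_le_mono)
      then show "40 * (k * k) + 6 \<le> 42 * (k * k)" by simp
    qed (use 3 in simp)
    finally have "real ((k + 1) ^ 2 * (K + 1) ^ 2) \<le> real (k ^ (42 * (k * k)))" by (rule of_nat_mono)
    also have "\<dots> = real k powr real (42 * (k * k))" using 3 by (subst powr_realpow) auto
    also have "\<dots> = (2 powr log 2 (real k)) powr real (42 * (k * k))" using 3 by simp
    also have "\<dots> = 2 powr (42 * (real k ^ 2 * log 2 (real k)))"
      unfolding powr_powr by (simp add: power2_eq_square algebra_simps)
    finally have "real ((k + 1) ^ 2 * (K + 1) ^ 2) \<le> 2 powr (42 * (real k ^ 2 * log 2 (real k)))" .
    also have "\<dots> \<le> 10 ^ 9 * 2 powr (42 * (real k ^ 2 * log 2 (real k)))" by simp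
    finally show ?thesis using le by linarith
  qed
qed

lemma box_prog_correct:
  assumes G: "simple_graph V E" and A: "A \<subseteq> V" "card A \<le> k"
    and clique: "complete_graph (V - A) (induced_edges E (V - A))"
    and vs: "distinct vs" "set vs = V"
  shows "\<exists>t s Is. run box_prog (input_state vs E) t s \<and> output_graphs vs s Is \<and>
    box_representation V E Is \<and> length Is = boxicity V E \<and>
    (V \<noteq> {} \<longrightarrow> real t \<le> 10 ^ 13 * real (card V) ^ 2 * 2 powr (10 ^ 13 * (real k ^ 2 * log 2 (real k))))"
proof -
  define n where "n = length vs"
  define D where "D = edge_positions vs E"
  define b where "b = boxicity V E"
  \<comment> \<open>The program works on positions in \<open>vs\<close>, so the cover is pulled back
    along the enumeration.\<close>
  define A' where "A' = {i. i < n \<and> vs ! i \<in> A}"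
  obtain Js where "length Js = card A" "box_representation V E Js"
    using box_representation_of_cover[OF G A(1) clique] by blast
  then have "b \<le> k" using boxicity_le A(2) unfolding b_def by fastforce
  obtain Is where Is: "length Is = b" "box_representation V E Is"
    using boxicity_attained[OF \<open>box_representation V E Js\<close>] unfolding b_def by blast
  have "finite A" using A(1) vs(2) finite_subset by blast
  have "card A' \<le> card A"
  proof (rule card_inj_on_le)
    show "inj_on ((!) vs) A'" using vs(1) by (intro inj_on_nth) (auto simp: A'_def n_def)
  qed (use \<open>finite A\<close> in \<open>auto simp: A'_def\<close>)
  then have "card A' \<le> k" using A(2) by simp
  have "finite A'" by (simp add: A'_def)
  have cov: "covers n D (n * n) A'"
    unfolding n_def D_def covers_iff
  proof (intro allI impI)
    fix i j assume ij: "i < length vs" "j < length vs" "i \<noteq> j" "{vs ! i, vs ! j} \<notin> E"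
    show "i \<in> A' \<or> j \<in> A'"
    proof (rule ccontr)
      assume "\<not> (i \<in> A' \<or> j \<in> A')"
      then have "{vs ! i, vs ! j} \<in> all_edges (V - A)"
        using ij vs by (auto simp: A'_def n_def pair_in_all_edges nth_eq_iff_index_eq)
      then show False using clique ij by (auto simp: complete_graph_def induced_edges_def)
    qed
  qed
  have "wp box_prog (input_state vs E)
    (\<lambda>t s'. t \<le> box_prog_bound n b ((8 * card A' + 2) ^ (4 * card A' * b)) \<and>
    fst s' 0 = b \<and> fst s' 1 = n * n + 3 * n \<and>
    (\<exists>S c. S \<subseteq> {..<n} \<and> covers n D (n * n) S \<and> good_cand n D S b c \<and> outputs_cand n D S b c s'))"
  proof (rule wp_box_prog[OF _ _ cov \<open>finite A'\<close>])
    show "fst (input_state vs E) = (\<lambda>x. if x = 0 then n else 0)"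
      by (auto simp: input_state_def n_def Let_def)
    show "snd (input_state vs E) = (\<lambda>a. of_bool (a < n * n \<and> a \<in> D))"
      by (auto simp: input_state_def n_def Let_def D_def edge_positions_def)
    show "\<exists>c < base S ^ (2 * card S * b). good_cand n D S b c"
      if "S \<subseteq> {..<n}" "covers n D (n * n) S" for S
      using box_representation_imp_good_cand[OF vs G _ _ Is(2)] that Is(1)
      unfolding n_def D_def by simp
    show "\<not> good_cand n D S d c" if "S \<subseteq> {..<n}" "d < b" for S d c
    proof
      assume "good_cand n D S d c"
      with that(1) have "boxicity V E \<le> d"
        unfolding n_def D_def
        using boxicity_le[OF good_cand_imp_box_representation[OF vs G]] by simp
      then show False using that(2) by (simp add: b_def)
    qed
  qed
  then obtain t s S c where run: "run box_prog (input_state vs E) t s"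
    and t: "t \<le> box_prog_bound n b ((8 * card A' + 2) ^ (4 * card A' * b))"
    and s: "fst s 0 = b" "fst s 1 = n * n + 3 * n"
    and S: "S \<subseteq> {..<n}" "good_cand n D S b c" "outputs_cand n D S b c s"
    unfolding wp_def by blast
  define Ks where "Ks = map (\<lambda>t. meet_edges vs (cand_left n D S c t) (cand_right n D S c t)) [0..<b]"
  have Ks: "box_representation V E Ks"
    using good_cand_imp_box_representation[OF vs G] S unfolding Ks_def n_def D_def by blast
  have out: "output_graphs vs s Ks"
    unfolding output_graphs_def Let_def n_def[symmetric]
  proof (intro conjI allI impI)
    show "fst s 0 = length Ks" using s by (simp add: Ks_def)
  next
    fix d i j assume d: "d < length Ks" and ij: "i < n" "j < n"
    then have db: "d < b" by (simp add: Ks_def)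
    have "snd s (n * n + 3 * n + d * (n * n) + (i * n + j)) =
      of_bool (meets (cand_left n D S c d) (cand_right n D S c d) i j)"
      using S(3) db index_pair_less[OF ij] ij unfolding outputs_cand_def by simp
    then show "snd s (fst s 1 + d * (n * n) + i * n + j) = (if {vs ! i, vs ! j} \<in> Ks ! d then 1 else 0)"
      using db ij vs(1) s by (simp add: Ks_def n_def meet_edges_iff add.assoc)
  qed
  \<comment> \<open>For \<open>V = {}\<close> the right-hand side would be 0, although every run
    takes time. The constants collected are \<open>3000 * 10 ^ 9\<close> in front and 42 in the
    exponent; \<open>10 ^ 13\<close> serves for both.\<close>
  have "real t \<le> 10 ^ 13 * real (card V) ^ 2 * 2 powr (10 ^ 13 * (real k ^ 2 * log 2 (real k)))" if "V \<noteq> {}"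
  proof -
    have nV: "card V = n" using vs distinct_card unfolding n_def by blast
    have n: "n \<ge> 1" using that vs unfolding n_def by (cases vs) auto
    let ?Y = "real k ^ 2 * log 2 (real k)"
    have Y: "?Y \<ge> 0" by (cases "k = 0") auto
    have "real t \<le> real (3000 * (n * n) * ((b + 1) ^ 2 * ((8 * card A' + 2) ^ (4 * card A' * b) + 1) ^ 2))"
      using t box_prog_bound_le[OF n] le_trans by (intro of_nat_mono) blast
    also have "\<dots> = 3000 * real n ^ 2 * real ((b + 1) ^ 2 * ((8 * card A' + 2) ^ (4 * card A' * b) + 1) ^ 2)"
      by (simp only: of_nat_mult power2_eq_square of_nat_numeral)
    also have "\<dots> \<le> 3000 * real n ^ 2 * (10 ^ 9 * 2 powr (42 * ?Y))"
      using candidate_count_le[OF \<open>card A' \<le> k\<close> \<open>b \<le> k\<close>] by (intro mult_left_mono) auto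
    also have "\<dots> \<le> 10 ^ 13 * real n ^ 2 * 2 powr (42 * ?Y)"
    proof -
      have "0 \<le> real n ^ 2 * 2 powr (42 * ?Y)" by simp
      then show ?thesis by (simp add: algebra_simps)
    qed
    also have "\<dots> \<le> 10 ^ 13 * real n ^ 2 * 2 powr (10 ^ 13 * ?Y)"
      using Y by (intro mult_left_mono powr_mono mult_right_mono) auto
    finally show ?thesis by (simp add: nV)
  qed
  moreover have "length Ks = boxicity V E" by (simp add: Ks_def b_def)
  ultimately show ?thesis using run out Ks by blast
qed

theorem theorem4:
  shows
    "(\<forall>(V :: 'a set) E A k.
        simple_graph V E \<and> A \<subseteq> V \<and> card A \<le> k \<and>
        complete_graph (V - A) (induced_edges E (V - A)) \<longrightarrow>
        boxicity V E \<le> k) \<and>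
     (\<exists>(P :: prog) (C :: real).
        \<forall>(V :: 'a set) E A k vs.
          simple_graph V E \<and> A \<subseteq> V \<and> card A \<le> k \<and>
          complete_graph (V - A) (induced_edges E (V - A)) \<and>
          distinct vs \<and> set vs = V \<longrightarrow>
          (\<exists>t s Is.
             run P (input_state vs E) t s \<and>
             output_graphs vs s Is \<and>
             box_representation V E Is \<and>
             length Is = boxicity V E \<and>
             (V \<noteq> {} \<longrightarrow>
                real t \<le> C * real (card V) ^ 2 * 2 powr (C * (real k ^ 2 * log 2 (real k))))))"
proof (intro conjI allI impI, goal_cases)
  case (1 V E A k)
  then show ?case
    using box_representation_of_cover[of V E A] boxicity_le[of V E] by fastforce
next
  case 2
  show ?case
    by (rule exI[of _ box_prog], rule exI[of _ "10 ^ 13"]) (use box_prog_correct in blast)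
qed

end
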